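(* Let a DC cube be defined by 8 (finite) corner points: $p_0,p_1,p_2,p_4\in\operatorname{Im}\mathbb H$, $p_3$ on the circle $\mathcal C(p_0,p_1,p_2)$, $p_5$ on the circle $\mathcal C(p_0,p_1,p_4)$, $p_6$ on the circle $\mathcal C(p_0,p_2,p_4)$, the associated Miquel point $p_7$, and by an orthonormal frame $(v_1,v_2,v_3)$ at $p_0$ with $v_3=v_1v_2$ (quaternion product). Let $q_i=(p_i-p_0)^{-1}$ for $i=1,\dots,7$. Then this cube can be parametrized by the quaternionic Bézier formula $$F(s,t,u)=\frac{\sum_{i,j,k=0}^{1}p_{ijk}w_{ijk}\,B^1_i(s)B^1_j(t)B^1_k(u)}{\sum_{i,j,k=0}^{1}w_{ijk}\,B^1_i(s)B^1_j(t)B^1_k(u)},$$ where $$w_0=1,\quad w_1=q_1v_1,\quad w_2=q_2v_2,\quad w_4=q_4v_3,$$ $$w_3=q_3(q_1-q_2)v_3,\quad w_5=q_5(q_4-q_1)v_2,\quad w_6=q_6(q_2-q_4)v_1,$$ $$\begin{aligned} w_7&=-q_7(q_7-q_1)^{-1}(q_4-q_1)(q_3-q_5)(q_1-q_2)\\ &=-q_7(q_7-q_2)^{-1}(q_1-q_2)(q_6-q_3)(q_2-q_4)\\ &=-q_7(q_7-q_4)^{-1}(q_2-q_4)(q_5-q_6)(q_4-q_1) \end{aligned}$$ (the three expressions for $w_7$ being equivalent).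
   Context: $\mathbb H$ is the algebra of real quaternions. $\operatorname{Im}\mathbb H$ is the space of purely imaginary quaternions, identified with Euclidean $\mathbb R^3$, and $\widehat{\mathbb R}^3=\operatorname{Im}\mathbb H\cup\{\infty\}$. The quaternionic fraction is $\frac{U}{W}=UW^{-1}$ if $W\neq0$, and $\frac UW=\infty$ if $W=0$. $B^1_0(t)=1-t$, $B^1_1(t)=t$. $\mathcal C(p,q,r)$ is the circle through the three points $p,q,r$. Index convention: a triple of binary digits $ijk$ is identified with the integer $i+2j+4k$, so $000=0$, $100=1$, $010=2$, $110=3$, $001=4$, $101=5$, $011=6$, $111=7$; thus $p_{ijk}=p_{i+2j+4k}$ and $w_{ijk}=w_{i+2j+4k}$. DC (Dupin cyclidic) cube: a map $F:[0,1]^3\to\widehat{\mathbb R}^3$, $F=U/W$, where $U,W$ are polynomials in the real variables $s,t,u$ with quaternionic coefficients, of degree at most one in each variable, such that $\partial_sF,\partial_tF,\partial_uF$ are mutually orthogonal and the Jacobian of $F$ is not identically zero. Its corner points are $p_{ijk}=F(i,j,k)$, $i,j,k\in\{0,1\}$. A DC cube is determined, up to reparametrization, by its three faces at the corner $p_0$, and these are determined by their corner points and the frame at $p_0$. The frame $(v_1,v_2,v_3)$ at $p_0$ means that $v_1,v_2,v_3$ are the tangent directions at $p_0$ of the edges joining $p_0$ to $p_1$, $p_2$, $p_4$ respectively. Miquel point: the common point of the circles $\mathcal C(p_1,p_3,p_5)$, $\mathcal C(p_2,p_3,p_6)$, $\mathcal C(p_4,p_5,p_6)$, provided by Miquel's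 theorem. *)

theory Defs
  imports "HOL-Analysis.Analysis"
begin

section \<open>Real quaternions\<close>

datatype quat = Quat (qRe: real) (qI: real) (qJ: real) (qK: real)

lemma quat_eq_iff: "x = y \<longleftrightarrow> qRe x = qRe y \<and> qI x = qI y \<and> qJ x = qJ y \<and> qK x = qK y"
  by (auto intro: quat.expand)

instantiation quat :: real_vector
begin

definition "0 = Quat 0 0 0 0"
definition "x + y = Quat (qRe x + qRe y) (qI x + qI y) (qJ x + qJ y) (qK x + qK y)"
definition "- x = Quat (- qRe x) (- qI x) (- qJ x) (- qK x)"
definition "x - y = Quat (qRe x - qRe y) (qI x - qI y) (qJ x - qJ y) (qK x - qK y)"
definition "scaleR r x = Quat (r * qRe x) (r * qI x) (r * qJ x) (r * qK x)"

instance
  by standard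
    (simp_all add: zero_quat_def plus_quat_def uminus_quat_def minus_quat_def scaleR_quat_def
      quat_eq_iff algebra_simps)

end

lemma quat_zero_sel [simp]: "qRe 0 = 0" "qI 0 = 0" "qJ 0 = 0" "qK 0 = 0"
  by (simp_all add: zero_quat_def)

lemma quat_plus_sel [simp]:
  "qRe (x + y) = qRe x + qRe y" "qI (x + y) = qI x + qI y"
  "qJ (x + y) = qJ x + qJ y" "qK (x + y) = qK x + qK y"
  by (simp_all add: plus_quat_def)

lemma quat_uminus_sel [simp]:
  "qRe (- x) = - qRe x" "qI (- x) = - qI x" "qJ (- x) = - qJ x" "qK (- x) = - qK x"
  by (simp_all add: uminus_quat_def)

lemma quat_minus_sel [simp]:
  "qRe (x - y) = qRe x - qRe y" "qI (x - y) = qI x - qI y"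
  "qJ (x - y) = qJ x - qJ y" "qK (x - y) = qK x - qK y"
  by (simp_all add: minus_quat_def)

lemma quat_scaleR_sel [simp]:
  "qRe (r *\<^sub>R x) = r * qRe x" "qI (r *\<^sub>R x) = r * qI x"
  "qJ (r *\<^sub>R x) = r * qJ x" "qK (r *\<^sub>R x) = r * qK x"
  by (simp_all add: scaleR_quat_def)

instantiation quat :: real_inner
begin

definition "inner x y = qRe x * qRe y + qI x * qI y + qJ x * qJ y + qK x * qK y"
definition "norm x = sqrt (inner x x)" for x :: quat
definition "sgn x = x /\<^sub>R norm x" for x :: quat
definition "dist x y = norm (x - y)" for x y :: quat
definition "(uniformity :: (quat \<times> quat) filter)
  = (INF e\<in>{0 <..}. principal {(x, y). dist x y < e})"
definition "open U \<longleftrightarrow> (\<forall>x\<in>U. eventually (\<lambda>(x', y). x' = x \<longrightarrow> y \<in> U) uniformity)"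
  for U :: "quat set"

instance
proof
  fix x y z :: quat and r :: real and U :: "quat set"
  show "dist x y = norm (x - y)" by (rule dist_quat_def)
  show "sgn x = x /\<^sub>R norm x" by (rule sgn_quat_def)
  show "(uniformity :: (quat \<times> quat) filter)
      = (INF e\<in>{0 <..}. principal {(x, y). dist x y < e})"
    by (rule uniformity_quat_def)
  show "open U \<longleftrightarrow> (\<forall>x\<in>U. eventually (\<lambda>(x', y). x' = x \<longrightarrow> y \<in> U) uniformity)"
    by (rule open_quat_def)
  show "inner x y = inner y x" by (simp add: inner_quat_def algebra_simps)
  show "inner (x + y) z = inner x z + inner y z" by (simp add: inner_quat_def algebra_simps)
  show "inner (r *\<^sub>R x) y = r * inner x y" by (simp add: inner_quat_def algebra_simps)
  show "0 \<le> inner x x" by (simp add: inner_quat_def)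
  show "inner x x = 0 \<longleftrightarrow> x = 0"
    by (auto simp: inner_quat_def quat_eq_iff add_nonneg_eq_0_iff)
  show "norm x = sqrt (inner x x)" by (rule norm_quat_def)
qed

end

instantiation quat :: real_normed_div_algebra
begin

definition "1 = Quat 1 0 0 0"
definition "x * y = Quat
  (qRe x * qRe y - qI x * qI y - qJ x * qJ y - qK x * qK y)
  (qRe x * qI y + qI x * qRe y + qJ x * qK y - qK x * qJ y)
  (qRe x * qJ y - qI x * qK y + qJ x * qRe y + qK x * qI y)
  (qRe x * qK y + qI x * qJ y - qJ x * qI y + qK x * qRe y)"
definition "inverse x = Quat (qRe x) (- qI x) (- qJ x) (- qK x) /\<^sub>R inner x x"
definition "x div y = x * inverse y" for x y :: quat

instance
proof
  fix x y z :: quat and r :: real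
  show "x * y * z = x * (y * z)"
    by (simp add: times_quat_def quat_eq_iff algebra_simps)
  show "(x + y) * z = x * z + y * z" "x * (y + z) = x * y + x * z"
    by (simp_all add: times_quat_def quat_eq_iff algebra_simps)
  show "1 * x = x" "x * 1 = x"
    by (simp_all add: times_quat_def one_quat_def quat_eq_iff)
  show "(0::quat) \<noteq> 1" by (simp add: one_quat_def quat_eq_iff)
  show "r *\<^sub>R x * y = r *\<^sub>R (x * y)" "x * r *\<^sub>R y = r *\<^sub>R (x * y)"
    by (simp_all add: times_quat_def quat_eq_iff algebra_simps)
  show "x div y = x * inverse y" by (rule divide_quat_def)
  show "inverse (0::quat) = 0" by (simp add: inverse_quat_def quat_eq_iff)
  show "norm (x * y) = norm x * norm y"
    unfolding norm_quat_def real_sqrt_mult [symmetric]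
    by (rule arg_cong [where f = sqrt]) (simp add: inner_quat_def times_quat_def algebra_simps)
  assume "x \<noteq> 0"
  then have nz: "inner x x \<noteq> 0" by simp
  have *: "qRe x * qRe x + qI x * qI x + qJ x * qJ x + qK x * qK x = inner x x"
    by (simp add: inner_quat_def)
  have "Quat (qRe x) (- qI x) (- qJ x) (- qK x) * x = inner x x *\<^sub>R 1"
    by (simp add: times_quat_def one_quat_def quat_eq_iff inner_quat_def)
  moreover have "(r *\<^sub>R a) * b = r *\<^sub>R (a * b)" "a * (r *\<^sub>R b) = r *\<^sub>R (a * b)"
    for r and a b :: quat
    by (simp_all add: times_quat_def quat_eq_iff algebra_simps)
  moreover have "x * Quat (qRe x) (- qI x) (- qJ x) (- qK x) = inner x x *\<^sub>R 1"
    by (simp add: times_quat_def one_quat_def quat_eq_iff inner_quat_def)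
  ultimately show "inverse x * x = 1" "x * inverse x = 1"
    using nz by (simp_all add: inverse_quat_def)
qed

end

definition ImH :: "quat set" where
  "ImH = {x. qRe x = 0}"

text \<open>The identification of the imaginary quaternions with \<open>\<real>\<^sup>3\<close>; the inner product and
  norm of \<^typ>\<open>quat\<close> restrict to the Euclidean ones.\<close>
definition im_vec :: "quat \<Rightarrow> real ^ 3" where
  "im_vec x = vector [qI x, qJ x, qK x]"


section \<open>The extended space, quaternionic fractions and circles\<close>

datatype hquat = Fin (fin_part: quat) | Infty
  where "fin_part Infty = 0"

definition hatR3 :: "hquat set" where
  "hatR3 = insert Infty (Fin ` ImH)"

definition qfrac :: "quat \<Rightarrow> quat \<Rightarrow> hquat" where
  "qfrac U W = (if W = 0 then Infty else Fin (U * inverse W))"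

text \<open>Circles of the extended space: lines completed by the point at infinity, and Euclidean
  circles (sphere of radius \<open>r > 0\<close> cut by a plane through its centre).\<close>
definition gen_circle :: "hquat set \<Rightarrow> bool" where
  "gen_circle C \<longleftrightarrow>
     (\<exists>a\<in>ImH. \<exists>d\<in>ImH. d \<noteq> 0 \<and> C = insert Infty (Fin ` {a + x *\<^sub>R d |x. True})) \<or>
     (\<exists>c\<in>ImH. \<exists>n\<in>ImH. \<exists>r>0. n \<noteq> 0 \<and>
        C = Fin ` {x \<in> ImH. dist x c = r \<and> inner (x - c) n = 0})"

text \<open>For three distinct points of \<^const>\<open>ImH\<close> exactly one circle contains all of them, and the
  union below is that circle. The definition is only used for distinct points.\<close>
definition circle_through :: "quat \<Rightarrow> quat \<Rightarrow> quat \<Rightarrow> hquat set" where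
  "circle_through p q r = \<Union>{C. gen_circle C \<and> Fin p \<in> C \<and> Fin q \<in> C \<and> Fin r \<in> C}"

text \<open>\<^emph>\<open>The\<close> common point of the three circles: if all of \<open>p\<^sub>0, \<dots>, p\<^sub>6\<close> lie on one circle, then
  the three circles coincide and there is no Miquel point.\<close>
definition miquel_point :: "(nat \<Rightarrow> quat) \<Rightarrow> quat \<Rightarrow> bool" where
  "miquel_point p m \<longleftrightarrow>
     circle_through (p 1) (p 3) (p 5) \<inter> circle_through (p 2) (p 3) (p 6)
       \<inter> circle_through (p 4) (p 5) (p 6) = {Fin m}"


section \<open>Dupin cyclidic cubes\<close>

definition trilinear_poly :: "(real \<Rightarrow> real \<Rightarrow> real \<Rightarrow> quat) \<Rightarrow> bool" where
  "trilinear_poly U \<longleftrightarrow> (\<exists>c :: nat \<Rightarrow> nat \<Rightarrow> nat \<Rightarrow> quat. \<forall>s t u.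
     U s t u = (\<Sum>i\<le>1. \<Sum>j\<le>1. \<Sum>k\<le>1. (s ^ i * t ^ j * u ^ k) *\<^sub>R c i j k))"

text \<open>Partial derivatives of a map on the unit cube (one-sided at its boundary); they are only
  used at points with a finite value.\<close>
definition pd_s :: "(real \<Rightarrow> real \<Rightarrow> real \<Rightarrow> hquat) \<Rightarrow> real \<Rightarrow> real \<Rightarrow> real \<Rightarrow> quat" where
  "pd_s F s t u = vector_derivative (\<lambda>x. fin_part (F x t u)) (at s within {0..1})"

definition pd_t :: "(real \<Rightarrow> real \<Rightarrow> real \<Rightarrow> hquat) \<Rightarrow> real \<Rightarrow> real \<Rightarrow> real \<Rightarrow> quat" where
  "pd_t F s t u = vector_derivative (\<lambda>x. fin_part (F s x u)) (at t within {0..1})"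

definition pd_u :: "(real \<Rightarrow> real \<Rightarrow> real \<Rightarrow> hquat) \<Rightarrow> real \<Rightarrow> real \<Rightarrow> real \<Rightarrow> quat" where
  "pd_u F s t u = vector_derivative (\<lambda>x. fin_part (F s t x)) (at u within {0..1})"

definition jacobian :: "(real \<Rightarrow> real \<Rightarrow> real \<Rightarrow> hquat) \<Rightarrow> real \<Rightarrow> real \<Rightarrow> real \<Rightarrow> real" where
  "jacobian F s t u =
     det (vector [im_vec (pd_s F s t u), im_vec (pd_t F s t u), im_vec (pd_u F s t u)] :: real ^ 3 ^ 3)"

text \<open>Only the values of \<open>F\<close> on the unit cube matter.\<close>
definition dc_cube :: "(real \<Rightarrow> real \<Rightarrow> real \<Rightarrow> hquat) \<Rightarrow> bool" where
  "dc_cube F \<longleftrightarrow>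
     (\<forall>s\<in>{0..1}. \<forall>t\<in>{0..1}. \<forall>u\<in>{0..1}. F s t u \<in> hatR3) \<and>
     (\<exists>U W. trilinear_poly U \<and> trilinear_poly W \<and>
        (\<forall>s\<in>{0..1}. \<forall>t\<in>{0..1}. \<forall>u\<in>{0..1}. F s t u = qfrac (U s t u) (W s t u))) \<and>
     (\<forall>s\<in>{0..1}. \<forall>t\<in>{0..1}. \<forall>u\<in>{0..1}. F s t u \<noteq> Infty \<longrightarrow>
        orthogonal (pd_s F s t u) (pd_t F s t u) \<and>
        orthogonal (pd_s F s t u) (pd_u F s t u) \<and>
        orthogonal (pd_t F s t u) (pd_u F s t u)) \<and>
     (\<exists>s\<in>{0..1}. \<exists>t\<in>{0..1}. \<exists>u\<in>{0..1}. F s t u \<noteq> Infty \<and> jacobian F s t u \<noteq> 0)"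

text \<open>A cube with finite corner points \<open>p\<^sub>0, \<dots>, p\<^sub>7\<close>.\<close>
definition has_corners :: "(real \<Rightarrow> real \<Rightarrow> real \<Rightarrow> hquat) \<Rightarrow> (nat \<Rightarrow> quat) \<Rightarrow> bool" where
  "has_corners F p \<longleftrightarrow> (\<forall>i\<in>{0,1}. \<forall>j\<in>{0,1}. \<forall>k\<in>{0,1}.
     F (real i) (real j) (real k) = Fin (p (i + 2 * j + 4 * k)))"

text \<open>Tangent directions are the unit vectors pointing into the edges; recall
  \<open>sgn x = x /\<^sub>R norm x\<close>.\<close>
definition has_frame :: "(real \<Rightarrow> real \<Rightarrow> real \<Rightarrow> hquat) \<Rightarrow> quat \<Rightarrow> quat \<Rightarrow> quat \<Rightarrow> bool" where
  "has_frame F v1 v2 v3 \<longleftrightarrow>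
     sgn (pd_s F 0 0 0) = v1 \<and> sgn (pd_t F 0 0 0) = v2 \<and> sgn (pd_u F 0 0 0) = v3"

text \<open>The fractional-linear bijections of \<open>[0,1]\<close> fixing both end points (for \<open>a > 0\<close>); applied
  in each variable they are the changes of parameter that preserve the form of a DC cube and its
  corner points.\<close>
definition moebius01 :: "real \<Rightarrow> real \<Rightarrow> real" where
  "moebius01 a x = a * x / ((1 - x) + a * x)"

definition reparametrization ::
  "(real \<Rightarrow> real \<Rightarrow> real \<Rightarrow> hquat) \<Rightarrow> (real \<Rightarrow> real \<Rightarrow> real \<Rightarrow> hquat) \<Rightarrow> bool" where
  "reparametrization G F \<longleftrightarrow> (\<exists>a>0. \<exists>b>0. \<exists>c>0. \<forall>s\<in>{0..1}. \<forall>t\<in>{0..1}. \<forall>u\<in>{0..1}.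
     G s t u = F (moebius01 a s) (moebius01 b t) (moebius01 c u))"

end

theory Submission
  imports Defs
begin

text \<open>In homogeneous coordinates \<open>z = (U, W)\<close> the extended space is the isotropic cone of the Hermitian
  form \<open>h(z, z') = cnj W U' + cnj U W'\<close>, and on an isotropic trilinear
  \<open>z\<close> one has \<open>\<partial>\<^sub>s(U / W) = (cnj W)\<^sup>-\<^sup>1 h(z(0,t,u), z(1,t,u)) W\<^sup>-\<^sup>1\<close>. For the weights of the theorem all
  coefficients of \<open>h(z(0,t,u), z(1,t,u))\<close> are real multiples of \<open>v\<^sub>1\<close>, and by the cyclic symmetry of
  the configuration the other two directions give multiples of \<open>v\<^sub>2\<close> and \<open>v\<^sub>3\<close>; this yields isotropy and
  orthogonality at once. After inversion at \<open>p\<^sub>0\<close> the points \<open>q\<^sub>3, q\<^sub>5, q\<^sub>6\<close> lie on the sides of the triangle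
  \<open>q\<^sub>1 q\<^sub>2 q\<^sub>4\<close>, which is non-degenerate because the Miquel point is unique, and \<open>q\<^sub>7\<^sup>-\<^sup>1 w\<^sub>7\<close> has an expression
  not involving \<open>q\<^sub>7\<close>; it matches the three given formulas because a combination of the powers of \<open>q\<^sub>7\<close>
  with respect to the three circles vanishes. Conversely, the coefficients of the isotropy and
  orthogonality conditions on the faces at \<open>p\<^sub>0\<close> determine \<open>w\<^sub>3, w\<^sub>5, w\<^sub>6\<close> from \<open>w\<^sub>1, w\<^sub>2, w\<^sub>4\<close>, and those
  on the opposite faces determine \<open>w\<^sub>7\<close>. The remaining freedom is three positive factors, which are
  absorbed by fractional linear changes of the parameters.\<close>

section \<open>Quaternion algebra\<close>

definition qcnj :: "quat \<Rightarrow> quat" where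
  "qcnj x = Quat (qRe x) (- qI x) (- qJ x) (- qK x)"

lemma qcnj_sel [simp]:
  "qRe (qcnj x) = qRe x" "qI (qcnj x) = - qI x" "qJ (qcnj x) = - qJ x" "qK (qcnj x) = - qK x"
  by (simp_all add: qcnj_def)

lemma quat_one_sel [simp]: "qRe 1 = 1" "qI 1 = 0" "qJ 1 = 0" "qK 1 = 0"
  by (simp_all add: one_quat_def)

lemma quat_times_sel:
  "qRe (x * y) = qRe x * qRe y - qI x * qI y - qJ x * qJ y - qK x * qK y"
  "qI (x * y) = qRe x * qI y + qI x * qRe y + qJ x * qK y - qK x * qJ y"
  "qJ (x * y) = qRe x * qJ y - qI x * qK y + qJ x * qRe y + qK x * qI y"
  "qK (x * y) = qRe x * qK y + qI x * qJ y - qJ x * qI y + qK x * qRe y"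
  by (simp_all add: times_quat_def)

lemma qcnj_simps [simp]:
  "qcnj 0 = 0" "qcnj 1 = 1" "qcnj (qcnj x) = x" "qcnj (- x) = - qcnj x"
  "qcnj (x + y) = qcnj x + qcnj y" "qcnj (x - y) = qcnj x - qcnj y"
  "qcnj (r *\<^sub>R x) = r *\<^sub>R qcnj x" "qcnj (x * y) = qcnj y * qcnj x"
  by (simp_all add: quat_eq_iff quat_times_sel)

lemma qcnj_eq_0_iff [simp]: "qcnj x = 0 \<longleftrightarrow> x = 0"
  by (simp add: quat_eq_iff)

lemma ImH_iff: "x \<in> ImH \<longleftrightarrow> qRe x = 0"
  by (simp add: ImH_def)

lemma ImH_closed [simp]:
  "0 \<in> ImH" "x \<in> ImH \<Longrightarrow> y \<in> ImH \<Longrightarrow> x + y \<in> ImH" "x \<in> ImH \<Longrightarrow> y \<in> ImH \<Longrightarrow> x - y \<in> ImH"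
  "x \<in> ImH \<Longrightarrow> - x \<in> ImH" "x \<in> ImH \<Longrightarrow> r *\<^sub>R x \<in> ImH" "x \<in> ImH \<Longrightarrow> inverse x \<in> ImH"
  by (simp_all add: ImH_iff inverse_quat_def)

lemma qcnj_ImH: "x \<in> ImH \<Longrightarrow> qcnj x = - x"
  by (simp add: ImH_iff quat_eq_iff)

lemma Reals_quat_iff: "x \<in> \<real> \<longleftrightarrow> qI x = 0 \<and> qJ x = 0 \<and> qK x = 0"
proof -
  have "x \<in> \<real>" if "qI x = 0 \<and> qJ x = 0 \<and> qK x = 0"
  proof -
    have "x = of_real (qRe x)" using that by (simp add: of_real_def quat_eq_iff)
    then show ?thesis by (metis Reals_of_real)
  qed
  then show ?thesis by (auto simp: Reals_def of_real_def)
qed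

lemma Reals_iff_qcnj: "x \<in> \<real> \<longleftrightarrow> qcnj x = x"
  by (auto simp: Reals_quat_iff quat_eq_iff)

lemma Reals_scaleR [simp]: "(x :: quat) \<in> \<real> \<Longrightarrow> r *\<^sub>R x \<in> \<real>"
  by (simp add: Reals_quat_iff)

lemma Reals_eq_scaleR: "(x :: quat) \<in> \<real> \<Longrightarrow> x = qRe x *\<^sub>R 1"
  by (simp add: Reals_quat_iff quat_eq_iff)

lemma add_qcnj: "x + qcnj x = (2 * qRe x) *\<^sub>R 1"
  by (simp add: quat_eq_iff)

lemma mult_qcnj: "x * qcnj x = (inner x x) *\<^sub>R 1" "qcnj x * x = (inner x x) *\<^sub>R 1"
  by (simp_all add: quat_eq_iff quat_times_sel inner_quat_def)

lemma ImH_square: "x \<in> ImH \<Longrightarrow> x * x = - (inner x x *\<^sub>R 1)"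
  by (simp add: ImH_iff quat_eq_iff quat_times_sel inner_quat_def)

lemma ImH_anticommutator:
  "x \<in> ImH \<Longrightarrow> y \<in> ImH \<Longrightarrow> x * y + y * x = - ((2 * inner x y) *\<^sub>R 1)"
  by (simp add: ImH_iff quat_eq_iff quat_times_sel inner_quat_def)

lemma orthogonal_anticommute:
  "x \<in> ImH \<Longrightarrow> y \<in> ImH \<Longrightarrow> inner x y = 0 \<Longrightarrow> y * x = - (x * y)"
  using ImH_anticommutator[of x y] by (simp add: eq_neg_iff_add_eq_0 add.commute)

text \<open>The norm is multiplicative, so two-sided multiplication is a similarity, and
  polarization carries this over to the inner product. Orthogonality of partial derivatives can then
  be tested without the factors coming from the denominator.\<close>

lemma inner_mult_mult:
  "inner (a * x * b) (a * y * b) = inner a a * inner b b * inner (x::quat) y"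
proof -
  have "a * x * b + a * y * b = a * (x + y) * b" by (simp add: algebra_simps)
  then have "inner (a * x * b) (a * y * b)
      = ((norm (a * (x + y) * b))\<^sup>2 - (norm (a * x * b))\<^sup>2 - (norm (a * y * b))\<^sup>2) / 2"
    by (simp add: dot_norm)
  also have "\<dots> = (norm a)\<^sup>2 * (norm b)\<^sup>2 * (((norm (x + y))\<^sup>2 - (norm x)\<^sup>2 - (norm y)\<^sup>2) / 2)"
    by (simp only: norm_mult power_mult_distrib) (simp add: field_simps)
  also have "\<dots> = inner a a * inner b b * inner x y"
    by (simp only: dot_norm[of x y] dot_square_norm)
  finally show ?thesis .
qed

text \<open>Moving \<open>v\<close> past \<open>x\<close> with the anticommutator leaves the
  reflection of \<open>x\<close> in the plane orthogonal to \<open>v\<close>.\<close>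

lemma ImH_reflection:
  assumes "v \<in> ImH" "x \<in> ImH" "v * v = - 1"
  shows "v * x * v = x - (2 * inner x v) *\<^sub>R v"
proof -
  have "v * x * v = (v * x + x * v) * v - x * (v * v)" by (simp add: distrib_right mult.assoc)
  then show ?thesis
    by (simp only: ImH_anticommutator[OF assms(1,2)] assms(3)) (simp add: inner_commute)
qed

text \<open>Multiplying the real product by \<open>x\<close> once more turns \<open>x * x\<close>
  into a nonzero real number, which can be divided out.\<close>

lemma ImH_parallel:
  assumes "x \<in> ImH" "y \<in> ImH" "x \<noteq> 0" "x * y \<in> \<real>"
  obtains k where "y = k *\<^sub>R x"
proof -
  have "x * y = qRe (x * y) *\<^sub>R 1" using assms(4) by (rule Reals_eq_scaleR)
  then have "x * (x * y) = qRe (x * y) *\<^sub>R x" by (metis mult_scaleR_right mult_1_right)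
  then have "- (inner x x *\<^sub>R y) = qRe (x * y) *\<^sub>R x"
    by (simp add: mult.assoc[symmetric] ImH_square assms(1))
  then have "(- 1 / inner x x) *\<^sub>R (- (inner x x *\<^sub>R y)) = (- 1 / inner x x) *\<^sub>R qRe (x * y) *\<^sub>R x"
    by simp
  then have "y = (- qRe (x * y) / inner x x) *\<^sub>R x"
    using assms(3) by simp
  then show ?thesis using that by blast
qed

text \<open>The imaginary part \<open>Q\<close> of \<open>P\<close> has a real product with each
  imaginary quaternion it commutes with. If nonzero, it would be parallel to both \<open>x\<close>
  and \<open>y\<close>, which are orthogonal and nonzero.\<close>

lemma commute_two_Reals:
  assumes "x \<in> ImH" "y \<in> ImH" "x \<noteq> 0" "y \<noteq> 0" "inner x y = 0" "P * x = x * P" "P * y = y * P"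
  shows "P \<in> \<real>"
proof -
  define Q where "Q = P - qRe P *\<^sub>R 1"
  have Q: "Q \<in> ImH" by (simp add: Q_def ImH_iff)
  have comm: "Q * z \<in> \<real>" if "z \<in> ImH" "P * z = z * P" for z
  proof -
    have "Q * z = z * Q" using that(2) by (simp add: Q_def algebra_simps)
    then show ?thesis by (simp add: Reals_iff_qcnj qcnj_ImH Q that(1))
  qed
  have "Q = 0"
  proof (rule ccontr)
    assume nz: "Q \<noteq> 0"
    obtain k l where "x = k *\<^sub>R Q" "y = l *\<^sub>R Q"
      using ImH_parallel[OF Q assms(1) nz comm[OF assms(1,6)]]
        ImH_parallel[OF Q assms(2) nz comm[OF assms(2,7)]] by metis
    then show False using assms(3-5) nz by simp
  qed
  then have "P = of_real (qRe P)" by (simp add: Q_def of_real_def)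
  then show ?thesis by (metis Reals_of_real)
qed

section \<open>Circles\<close>

text \<open>For equal radii the chord \<open>A - B\<close> intertwines \<open>A\<close> and \<open>- B\<close>, hence the product of the four
  sides of an inscribed quadrilateral commutes with the radius \<open>A\<close>.\<close>
lemma gen_circle_product_real:
  assumes "gen_circle C" "Fin a \<in> C" "Fin b \<in> C" "Fin c \<in> C" "Fin d \<in> C"
  shows "(a - b) * (b - c) * (c - d) * (d - a) \<in> \<real>"
  using assms(1) unfolding gen_circle_def
proof (elim disjE bexE exE conjE)
  fix a0 e assume C: "C = insert Infty (Fin ` {a0 + x *\<^sub>R e |x. True})" and e: "e \<in> ImH"
  obtain ra rb rc rd where *: "a = a0 + ra *\<^sub>R e" "b = a0 + rb *\<^sub>R e" "c = a0 + rc *\<^sub>R e" "d = a0 + rd *\<^sub>R e"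
    using assms(2-) C by auto
  have "(a - b) * (b - c) * (c - d) * (d - a)
      = ((ra - rb) *\<^sub>R e) * ((rb - rc) *\<^sub>R e) * ((rc - rd) *\<^sub>R e) * ((rd - ra) *\<^sub>R e)"
    by (simp add: * scaleR_diff_left)
  also have "\<dots> = ((ra - rb) * (rb - rc) * (rc - rd) * (rd - ra)) *\<^sub>R (e * e * (e * e))"
    by (simp add: mult.assoc mult.left_commute)
  also have "\<dots> \<in> \<real>" by (simp add: ImH_square e Reals_quat_iff)
  finally show ?thesis .
next
  fix c0 n r
  assume c0: "c0 \<in> ImH" and n: "n \<in> ImH" "n \<noteq> 0" and r: "0 < r"
    and C: "C = Fin ` {x \<in> ImH. dist x c0 = r \<and> inner (x - c0) n = 0}"
  \<comment> \<open>These are the radius vectors of the circle: of length \<open>r\<close> and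
    orthogonal to the normal \<open>n\<close> of its plane.\<close>
  define rad where "rad x \<longleftrightarrow> x \<in> ImH \<and> x * x = - ((r * r) *\<^sub>R 1) \<and> inner x n = 0" for x
  have rad: "rad (x - c0)" if "Fin x \<in> C" for x
  proof -
    have "x - c0 \<in> ImH" "norm (x - c0) = r" "inner (x - c0) n = 0"
      using that C c0 by (auto simp: dist_norm)
    then show ?thesis by (simp add: rad_def ImH_square dot_square_norm power2_eq_square)
  qed
  define A B D E where "A = a - c0" "B = b - c0" "D = c - c0" "E = d - c0"
  have ABDE: "rad A" "rad B" "rad D" "rad E"
    using rad assms by (auto simp: A_B_D_E_def)
  have swap: "x * (x - y) = - ((x - y) * y)" if "rad x" "rad y" for x y
    using that by (simp add: rad_def algebra_simps)
  \<comment> \<open>Chords are orthogonal to \<open>n\<close>, so moving \<open>n\<close> through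
    four of them changes the sign four times. With the radius \<open>A\<close> this gives two
    orthogonal directions that commute with the product.\<close>
  have anti: "n * (x - y) = - ((x - y) * n)" if "rad x" "rad y" for x y
    by (rule orthogonal_anticommute) (use that n in \<open>auto simp: rad_def inner_diff_left\<close>)
  let ?P = "(A - B) * (B - D) * (D - E) * (E - A)"
  have "?P \<in> \<real>"
  proof (rule commute_two_Reals)
    show "A \<in> ImH" "n \<in> ImH" "n \<noteq> 0" "inner A n = 0" using ABDE n by (auto simp: rad_def)
    have "A * A \<noteq> 0" using ABDE(1) r by (simp add: rad_def)
    then show "A \<noteq> 0" by auto
    have "A * ?P = - ((A - B) * (B * (B - D)) * (D - E) * (E - A))"
      by (simp only: mult.assoc[symmetric] swap[OF ABDE(1) ABDE(2)]) (simp add: mult.assoc)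
    also have "\<dots> = (A - B) * (B - D) * (D * (D - E)) * (E - A)"
      by (subst swap[OF ABDE(2) ABDE(3)]) (simp add: mult.assoc)
    also have "\<dots> = - ((A - B) * (B - D) * (D - E) * (E * (E - A)))"
      by (subst swap[OF ABDE(3) ABDE(4)]) (simp add: mult.assoc)
    also have "\<dots> = ?P * A"
      by (subst swap[OF ABDE(4) ABDE(1)]) (simp add: mult.assoc)
    finally show "?P * A = A * ?P" by simp
    have "n * ?P = - ((A - B) * (n * (B - D)) * (D - E) * (E - A))"
      by (simp only: mult.assoc[symmetric] anti[OF ABDE(1) ABDE(2)]) (simp add: mult.assoc)
    also have "\<dots> = (A - B) * (B - D) * (n * (D - E)) * (E - A)"
      by (subst anti[OF ABDE(2) ABDE(3)]) (simp add: mult.assoc)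
    also have "\<dots> = - ((A - B) * (B - D) * (D - E) * (n * (E - A)))"
      by (subst anti[OF ABDE(3) ABDE(4)]) (simp add: mult.assoc)
    also have "\<dots> = ?P * n"
      by (subst anti[OF ABDE(4) ABDE(1)]) (simp add: mult.assoc)
    finally show "?P * n = n * ?P" by simp
  qed
  then show ?thesis by (simp add: A_B_D_E_def)
qed

lemma circle_throughD:
  assumes "Fin x \<in> circle_through a b c"
  obtains C where "gen_circle C" "Fin a \<in> C" "Fin b \<in> C" "Fin c \<in> C" "Fin x \<in> C"
  using assms by (auto simp: circle_through_def)

lemma circle_throughI:
  "gen_circle C \<Longrightarrow> Fin a \<in> C \<Longrightarrow> Fin b \<in> C \<Longrightarrow> Fin c \<in> C \<Longrightarrow> x \<in> C \<Longrightarrow> x \<in> circle_through a b c"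
  by (auto simp: circle_through_def)

section \<open>Inversion of circles and concyclic points\<close>

lemma inverse_diff: "a \<noteq> 0 \<Longrightarrow> b \<noteq> 0 \<Longrightarrow> inverse a - inverse b = inverse a * (b - a) * inverse (b::quat)"
  by (simp add: left_diff_distrib right_diff_distrib mult.assoc)

text \<open>Inversion maps circles to circles, and circles through its centre to lines.\<close>
lemma product_real_inverse:
  assumes "a \<in> ImH" "b \<in> ImH" "c \<in> ImH" "d \<in> ImH" "a \<noteq> 0" "b \<noteq> 0" "c \<noteq> 0" "d \<noteq> 0"
    and "(a - b) * (b - c) * (c - d) * (d - a) \<in> \<real>"
  shows "(inverse a - inverse b) * (inverse b - inverse c) * (inverse c - inverse d)
    * (inverse d - inverse a) \<in> \<real>"
proof -
  define qa qb qc qd where q: "qa = inverse a" "qb = inverse b" "qc = inverse c" "qd = inverse d"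
  have sq: "x * (x * y) = - (inner x x *\<^sub>R y)" if "x \<in> ImH" for x y :: quat
    by (simp add: mult.assoc[symmetric] ImH_square that)
  let ?P = "(a - b) * (b - c) * (c - d) * (d - a)"
  have qI: "qa \<in> ImH" "qb \<in> ImH" "qc \<in> ImH" "qd \<in> ImH" by (simp_all add: q assms)
  have P: "(b - a) * (c - b) * (d - c) * (a - d) = ?P"
    by (simp only: minus_diff_eq[of a b, symmetric] minus_diff_eq[of b c, symmetric]
      minus_diff_eq[of c d, symmetric] minus_diff_eq[of d a, symmetric] mult_minus_left mult_minus_right minus_minus)
  have "(inverse a - inverse b) * (inverse b - inverse c) * (inverse c - inverse d) * (inverse d - inverse a)
      = (qa * (b - a) * qb) * (qb * (c - b) * qc) * (qc * (d - c) * qd) * (qd * (a - d) * qa)"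
    by (simp add: inverse_diff assms q)
  \<comment> \<open>The doubled inner factors are squares of imaginary quaternions, hence real;
    \<open>qa\<close> remains on both sides of the real number \<open>?P\<close>.\<close>
  also have "\<dots> = - ((inner qb qb * inner qc qc * inner qd qd) *\<^sub>R (qa * ((b - a) * (c - b) * (d - c) * (a - d)) * qa))"
    by (simp only: mult.assoc sq qI mult_scaleR_left mult_scaleR_right mult_minus_left
      mult_minus_right scaleR_scaleR minus_minus scaleR_minus_right)
  also have "\<dots> = - ((inner qb qb * inner qc qc * inner qd qd) *\<^sub>R (qa * (qRe ?P *\<^sub>R 1) * qa))"
    by (simp only: P Reals_eq_scaleR[OF assms(9), symmetric])
  also have "\<dots> \<in> \<real>" by (simp add: ImH_square qI)
  finally show ?thesis .
qed

text \<open>The degenerate case with one point at the centre of inversion. Reality makes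
  \<open>(b - c) * (c - d)\<close> a real multiple of \<open>inverse b * inverse d\<close>, and
  after substitution only squares of imaginary quaternions remain. By \<open>ImH_parallel\<close>
  the conclusion expresses collinearity of the images.\<close>

lemma product_real_inverse_line:
  assumes "b \<in> ImH" "c \<in> ImH" "d \<in> ImH" "b \<noteq> 0" "c \<noteq> 0" "d \<noteq> 0"
    and "(0 - b) * (b - c) * (c - d) * (d - 0) \<in> \<real>"
  shows "(inverse b - inverse c) * (inverse c - inverse d) \<in> \<real>"
proof -
  let ?P = "(0 - b) * (b - c) * (c - d) * (d - 0)"
  have P: "?P = qRe ?P *\<^sub>R 1" using assms(7) by (rule Reals_eq_scaleR)
  have "(b - c) * (c - d) = - (inverse b * ?P * inverse d)"
    using assms by (simp add: mult.assoc[symmetric]) (simp add: mult.assoc)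
  also have "\<dots> = - (qRe ?P *\<^sub>R (inverse b * inverse d))"
    by (subst P) simp
  finally have *: "(b - c) * (c - d) = - (qRe ?P *\<^sub>R (inverse b * inverse d))" .
  have "(inverse b - inverse c) * (inverse c - inverse d)
      = inverse b * (c - b) * (inverse c * inverse c) * (d - c) * inverse d"
    by (simp add: inverse_diff assms mult.assoc)
  also have "\<dots> = - (inner (inverse c) (inverse c) *\<^sub>R (inverse b * ((c - b) * (d - c)) * inverse d))"
    by (simp add: ImH_square assms mult.assoc)
  also have "(c - b) * (d - c) = (b - c) * (c - d)" by (simp add: algebra_simps)
  also have "inverse b * ((b - c) * (c - d)) * inverse d
      = - (qRe ?P *\<^sub>R ((inverse b * inverse b) * (inverse d * inverse d)))"
    by (simp only: *) (simp add: mult.assoc)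
  finally show ?thesis by (simp add: ImH_square assms)
qed

text \<open>Needed to show that the triangle \<open>q 1\<close>, \<open>q 2\<close>,
  \<open>q 4\<close> cannot degenerate. Inversion at a point of a Euclidean circle makes its
  equations affine, so they pass to affine combinations.\<close>

lemma gen_circle_contains_inverse_line:
  assumes C: "gen_circle C" "Fin a \<in> C" "Fin b \<in> C" "Fin c \<in> C"
    and neq: "b \<noteq> a" "c \<noteq> a" "x \<noteq> a" "x \<in> ImH"
    and x: "inverse (x - a) = inverse (b - a) + k *\<^sub>R (inverse (c - a) - inverse (b - a))"
  shows "Fin x \<in> C"
  using C(1) unfolding gen_circle_def
proof (elim disjE bexE exE conjE)
  fix a0 e assume C': "C = insert Infty (Fin ` {a0 + x *\<^sub>R e |x. True})" and e: "e \<noteq> 0"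
  obtain ra rb rc where *: "a = a0 + ra *\<^sub>R e" "b = a0 + rb *\<^sub>R e" "c = a0 + rc *\<^sub>R e"
    using C C' by auto
  have "b - a = (rb - ra) *\<^sub>R e" "c - a = (rc - ra) *\<^sub>R e"
    by (simp_all add: * scaleR_diff_left)
  then have "\<exists>t. inverse (x - a) = t *\<^sub>R inverse e"
    unfolding x by (auto simp: inverse_scaleR_distrib scaleR_diff_left[symmetric] scaleR_add_left[symmetric])
  then obtain t where "inverse (x - a) = t *\<^sub>R inverse e" by blast
  then have "x - a = inverse (t *\<^sub>R inverse e)" by (metis inverse_inverse_eq)
  then have "x - a = inverse t *\<^sub>R e" by (simp add: inverse_scaleR_distrib)
  then have "x = a0 + (ra + inverse t) *\<^sub>R e" by (simp add: * algebra_simps)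
  then show ?thesis by (auto simp: C')
next
  fix c0 n r
  assume c0: "c0 \<in> ImH" and n: "n \<in> ImH" "n \<noteq> 0" and r: "0 < r"
    and C': "C = Fin ` {x \<in> ImH. dist x c0 = r \<and> inner (x - c0) n = 0}"
  define A where "A = a - c0"
  have A: "a \<in> ImH" "inner A A = r * r" "inner A n = 0"
    using C(2) C' by (auto simp: A_def dist_norm dot_square_norm power2_eq_square)
  have inv: "inverse y = - (y /\<^sub>R inner y y)" if "y \<in> ImH" for y
    using that by (simp add: inverse_quat_def ImH_iff quat_eq_iff)
  \<comment> \<open>With \<open>Y = y - a\<close> the sphere equation reads
    \<open>inner Y Y + 2 * inner Y A = 0\<close>; division by \<open>inner Y Y\<close> makes it
    affine in \<open>inverse Y\<close>.\<close>
  have iff: "Fin y \<in> C \<longleftrightarrow> 2 * inner (inverse (y - a)) A = 1 \<and> inner (inverse (y - a)) n = 0"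
    if "y \<in> ImH" "y \<noteq> a" for y
  proof -
    define Y where "Y = y - a"
    have Y: "Y \<noteq> 0" "Y \<in> ImH" using that A by (auto simp: Y_def)
    have yc: "y - c0 = Y + A" by (simp add: Y_def A_def)
    have "Fin y \<in> C \<longleftrightarrow> norm (Y + A) = r \<and> inner (Y + A) n = 0"
      using that by (auto simp: C' dist_norm yc)
    also have "norm (Y + A) = r \<longleftrightarrow> inner (Y + A) (Y + A) = r * r"
      using r by (metis dot_square_norm norm_ge_zero order_less_imp_le power2_eq_square power2_eq_iff_nonneg)
    also have "\<dots> \<longleftrightarrow> inner Y Y + 2 * inner Y A = 0"
      using A by (simp add: inner_add_left inner_add_right inner_commute add.commute)
    also have "\<dots> \<longleftrightarrow> 2 * inner (inverse Y) A = 1"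
      using Y by (simp add: inv) (auto simp: field_simps)
    also have "inner (Y + A) n = 0 \<longleftrightarrow> inner (inverse Y) n = 0"
      using Y A by (simp add: inv inner_add_left)
    finally show ?thesis by (simp add: Y_def)
  qed
  have bc: "b \<in> ImH" "c \<in> ImH" using C C' by auto
  have "2 * inner (inverse (b - a)) A = 1 \<and> inner (inverse (b - a)) n = 0"
    "2 * inner (inverse (c - a)) A = 1 \<and> inner (inverse (c - a)) n = 0"
    using iff bc neq C by auto
  then show ?thesis
    by (simp add: iff neq x inner_add_left inner_diff_left)
qed

text \<open>On the plane of the circle through \<open>0\<close>, \<open>a\<close>, \<open>b\<close>,
  its equation says that \<open>inner y y\<close> equals the linear form with values
  \<open>inner a a\<close> at \<open>a\<close> and \<open>inner b b\<close> at \<open>b\<close>.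
  Both conclusions come from one fact: \<open>(b - y) * y\<close> is a real multiple of
  \<open>(b - a) * a\<close>.\<close>

lemma concyclic_coordinates:
  assumes "a \<in> ImH" "b \<in> ImH" "y \<in> ImH" "a \<noteq> 0" "b \<noteq> 0" "a \<noteq> b"
    and real: "(0 - a) * (a - b) * (b - y) * (y - 0) \<in> \<real>"
  obtains x z where "y = x *\<^sub>R a + z *\<^sub>R b" "inner y y = x * inner a a + z * inner b b"
proof -
  let ?r = "qRe ((0 - a) * (a - b) * (b - y) * (y - 0))"
  define S where "S = a * (b - a)"
  have S: "S \<noteq> 0" using assms by (simp add: S_def)
  have "S * ((b - y) * y) = ?r *\<^sub>R 1"
    using Reals_eq_scaleR[OF real] by (simp add: S_def algebra_simps)
  then have "qcnj S * (S * ((b - y) * y)) = ?r *\<^sub>R qcnj S" by simp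
  then have "inner S S *\<^sub>R ((b - y) * y) = ?r *\<^sub>R qcnj S"
    by (simp only: mult.assoc[symmetric] mult_qcnj) simp
  then have "(1 / inner S S) *\<^sub>R inner S S *\<^sub>R ((b - y) * y) = (1 / inner S S) *\<^sub>R ?r *\<^sub>R qcnj S" by simp
  moreover define x where "x = ?r / inner S S"
  ultimately have "(b - y) * y = x *\<^sub>R qcnj S" using S by simp
  moreover have "qcnj S = (b - a) * a" by (simp add: S_def qcnj_ImH assms algebra_simps)
  ultimately have "b * y - y * y = x *\<^sub>R (b * a - a * a)" by (simp add: algebra_simps)
  then have *: "b * (y - x *\<^sub>R a) = (x * inner a a - inner y y) *\<^sub>R 1"
    by (simp add: ImH_square assms algebra_simps)
  then have "b * (y - x *\<^sub>R a) \<in> \<real>" by (simp add: Reals_quat_iff)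
  then obtain z where z: "y - x *\<^sub>R a = z *\<^sub>R b"
    using ImH_parallel[OF assms(2) _ assms(5)] assms by (metis ImH_closed(3,5))
  then have "- (z * inner b b) *\<^sub>R (1::quat) = (x * inner a a - inner y y) *\<^sub>R 1"
    using * by (simp add: ImH_square assms)
  then have "inner y y = x * inner a a + z * inner b b"
    by (simp only: scaleR_cancel_right) simp
  moreover have "y = x *\<^sub>R a + z *\<^sub>R b" using z by (simp add: algebra_simps)
  ultimately show ?thesis using that by blast
qed

section \<open>The Miquel configuration\<close>

text \<open>For \<open>M = q\<^sub>1 - q\<^sub>2\<close>, \<open>N = q\<^sub>2 - q\<^sub>4\<close>, \<open>L = q\<^sub>4 - q\<^sub>1\<close> this is the common value \<open>q\<^sub>7\<^sup>-\<^sup>1 w\<^sub>7\<close> of the three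
  formulas for the last weight, written without reference to \<open>q\<^sub>7\<close>.\<close>
definition apex :: "quat \<Rightarrow> quat \<Rightarrow> quat \<Rightarrow> real \<Rightarrow> real \<Rightarrow> real \<Rightarrow> quat" where
  "apex M N L \<alpha> \<beta> \<gamma> =
     ((\<alpha> - 1) * inner M M + (\<beta> - 1) * inner N N + \<gamma> * inner L L) *\<^sub>R 1 + M * N"

text \<open>The two sides differ by the real number \<open>inner M M + inner N N - inner L L\<close>
  minus \<open>M * N + N * M\<close>, which is zero because \<open>L = - M - N\<close>.\<close>

lemma apex_rotate:
  assumes "M \<in> ImH" "N \<in> ImH" "M + N + L = 0"
  shows "apex N L M \<beta> \<gamma> \<alpha> = apex M N L \<alpha> \<beta> \<gamma>"
proof -
  have L: "L = - M - N" using assms(3) by (simp add: algebra_simps eq_neg_iff_add_eq_0)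
  show ?thesis using assms
    unfolding L apex_def
    by (simp add: quat_eq_iff ImH_iff quat_times_sel inner_quat_def algebra_simps)
qed

text \<open>The three bracketed factors are the powers of \<open>y\<close> with respect to the three Miquel circles.\<close>
lemma apex_power_identity:
  assumes "M \<in> ImH" "N \<in> ImH" "M + N + L = 0" "y = x *\<^sub>R M + z *\<^sub>R L"
  shows "y * apex M N L \<alpha> \<beta> \<gamma> + L * ((\<alpha> - 1) *\<^sub>R M - \<gamma> *\<^sub>R L) * M
    = (inner y y - x * (\<alpha> - 1) * inner M M - z * \<gamma> * inner L L) *\<^sub>R N
    + (inner (y + M) (y + M) + z * (\<beta> - 1) * inner N N - (x + 1 - z) * \<alpha> * inner M M) *\<^sub>R L
    + (inner (y - L) (y - L) - (z - 1 - x) * (\<gamma> - 1) * inner L L + x * \<beta> * inner N N) *\<^sub>R M"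
proof -
  have L: "L = - M - N" using assms(3) by (simp add: algebra_simps eq_neg_iff_add_eq_0)
  show ?thesis using assms(1,2)
    unfolding assms(4) L apex_def
    by (simp add: quat_eq_iff ImH_iff quat_times_sel inner_quat_def algebra_simps)
qed

text \<open>Here \<open>y\<close> stands for \<open>q7 - q1\<close>, and \<open>c1\<close>,
  \<open>c2\<close>, \<open>c4\<close> put \<open>q7\<close> on the three Miquel circles, translated
  so that \<open>q1\<close>, \<open>q2\<close>, \<open>q4\<close> respectively becomes the origin.
  Each circle makes one power in \<open>apex_power_identity\<close> vanish.\<close>

lemma miquel_apex:
  assumes ImH: "M \<in> ImH" "N \<in> ImH" "y \<in> ImH" and sum: "M + N + L = 0"
    and indep: "\<And>a b. a *\<^sub>R M + b *\<^sub>R N = 0 \<Longrightarrow> a = 0 \<and> b = 0"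
    and nz: "\<alpha> \<noteq> 0" "\<alpha> \<noteq> 1" "\<beta> \<noteq> 0" "\<beta> \<noteq> 1" "\<gamma> \<noteq> 0" "\<gamma> \<noteq> 1"
    and c1: "(0 - (\<alpha> - 1) *\<^sub>R M) * ((\<alpha> - 1) *\<^sub>R M - \<gamma> *\<^sub>R L) * (\<gamma> *\<^sub>R L - y) * (y - 0) \<in> \<real>"
    and c2: "(0 - (\<beta> - 1) *\<^sub>R N) * ((\<beta> - 1) *\<^sub>R N - \<alpha> *\<^sub>R M) * (\<alpha> *\<^sub>R M - (y + M)) * ((y + M) - 0) \<in> \<real>"
    and c4: "(0 - (\<gamma> - 1) *\<^sub>R L) * ((\<gamma> - 1) *\<^sub>R L - \<beta> *\<^sub>R N) * (\<beta> *\<^sub>R N - (y - L)) * ((y - L) - 0) \<in> \<real>"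
  shows "y * apex M N L \<alpha> \<beta> \<gamma> = - (L * ((\<alpha> - 1) *\<^sub>R M - \<gamma> *\<^sub>R L) * M)"
proof -
  have L: "L = - M - N" using sum by (simp add: algebra_simps eq_neg_iff_add_eq_0)
  have ne: "M \<noteq> 0" "N \<noteq> 0" "L \<noteq> 0" using indep[of 1 0] indep[of 0 1] indep[of 1 1] L
    by (auto simp: algebra_simps)
  have LI: "L \<in> ImH" using ImH by (simp add: L)
  have coords: "a = c \<and> b = d" if "a *\<^sub>R M + b *\<^sub>R N = c *\<^sub>R M + d *\<^sub>R N" for a b c d
    using indep[of "a - c" "b - d"] that by (simp add: algebra_simps)
  have n1: "(\<alpha> - 1) *\<^sub>R M \<noteq> \<gamma> *\<^sub>R L" and n2: "(\<beta> - 1) *\<^sub>R N \<noteq> \<alpha> *\<^sub>R M" and n4: "(\<gamma> - 1) *\<^sub>R L \<noteq> \<beta> *\<^sub>R N"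
    using coords[of "\<alpha> - 1" 0 "- \<gamma>" "- \<gamma>"] coords[of 0 "\<beta> - 1" \<alpha> 0]
      coords[of "1 - \<gamma>" "1 - \<gamma>" 0 \<beta>] nz
    by (auto simp: L algebra_simps)
  obtain x1 z1 where 1: "y = x1 *\<^sub>R (\<alpha> - 1) *\<^sub>R M + z1 *\<^sub>R \<gamma> *\<^sub>R L"
      "inner y y = x1 * inner ((\<alpha> - 1) *\<^sub>R M) ((\<alpha> - 1) *\<^sub>R M) + z1 * inner (\<gamma> *\<^sub>R L) (\<gamma> *\<^sub>R L)"
    by (rule concyclic_coordinates[OF _ _ _ _ _ n1 c1]) (use ImH LI ne nz in auto)
  obtain x2 z2 where 2: "y + M = x2 *\<^sub>R (\<beta> - 1) *\<^sub>R N + z2 *\<^sub>R \<alpha> *\<^sub>R M"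
      "inner (y + M) (y + M) = x2 * inner ((\<beta> - 1) *\<^sub>R N) ((\<beta> - 1) *\<^sub>R N) + z2 * inner (\<alpha> *\<^sub>R M) (\<alpha> *\<^sub>R M)"
    by (rule concyclic_coordinates[OF _ _ _ _ _ n2 c2]) (use ImH LI ne nz in auto)
  obtain x4 z4 where 4: "y - L = x4 *\<^sub>R (\<gamma> - 1) *\<^sub>R L + z4 *\<^sub>R \<beta> *\<^sub>R N"
      "inner (y - L) (y - L) = x4 * inner ((\<gamma> - 1) *\<^sub>R L) ((\<gamma> - 1) *\<^sub>R L) + z4 * inner (\<beta> *\<^sub>R N) (\<beta> *\<^sub>R N)"
    by (rule concyclic_coordinates[OF _ _ _ _ _ n4 c4]) (use ImH LI ne nz in auto)
  define x z where "x = x1 * (\<alpha> - 1)" "z = z1 * \<gamma>"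
  have y: "y = x *\<^sub>R M + z *\<^sub>R L" using 1(1) by (simp add: x_z_def)
  \<comment> \<open>The three expansions describe the same point. Independence of \<open>M\<close>
    and \<open>N\<close> expresses the coefficients for the other two circles through
    \<open>x\<close> and \<open>z\<close>.\<close>
  have e2: "x + 1 - z = z2 * \<alpha> \<and> - z = x2 * (\<beta> - 1)"
    by (rule coords) (use 2(1) in \<open>simp add: y L algebra_simps\<close>)
  have e4: "x + 1 - z = - (x4 * (\<gamma> - 1)) \<and> 1 - z = z4 * \<beta> - x4 * (\<gamma> - 1)"
    by (rule coords) (use 4(1) in \<open>simp add: y L algebra_simps\<close>)
  have f1: "inner y y - x * (\<alpha> - 1) * inner M M - z * \<gamma> * inner L L = 0"
    using 1(2) by (simp add: x_z_def)
  have "x2 * (\<beta> - 1) * (\<beta> - 1) = - z * (\<beta> - 1)" "z2 * \<alpha> * \<alpha> = (x + 1 - z) * \<alpha>" using e2 by simp_all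
  then have f2: "inner (y + M) (y + M) + z * (\<beta> - 1) * inner N N - (x + 1 - z) * \<alpha> * inner M M = 0"
    using 2(2) by (simp add: mult.assoc[symmetric])
  have "x4 * (\<gamma> - 1) = z - 1 - x" "z4 * \<beta> = - x" using e4 by auto
  then have "x4 * (\<gamma> - 1) * (\<gamma> - 1) = (z - 1 - x) * (\<gamma> - 1)" "z4 * \<beta> * \<beta> = - x * \<beta>" by simp_all
  then have f4: "inner (y - L) (y - L) - (z - 1 - x) * (\<gamma> - 1) * inner L L + x * \<beta> * inner N N = 0"
    using 4(2) by (simp add: mult.assoc[symmetric])
  show ?thesis
    using apex_power_identity[OF ImH(1,2) sum y, of \<alpha> \<beta> \<gamma>]
    unfolding f1 f2 f4 by (simp add: eq_neg_iff_add_eq_0)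
qed

lemma scaleR_in_span_singleton: "r *\<^sub>R v \<in> span {v}"
  by (simp add: span_base span_scale)

text \<open>The configuration after inversion at \<open>p 0\<close>, with sides and side points in
  cyclic order, so that \<open>rotate\<close> merely permutes the arguments. The assumption on
  \<open>q7\<close> avoids \<open>inverse (q7 - q1)\<close>, since \<open>q7 \<noteq> q1\<close> is
  to be derived from it.\<close>

locale miquel_frame =
  fixes v1 v2 v3 q1 q2 q4 q3 q6 q5 q7 M N L m :: quat and \<alpha> \<beta> \<gamma> :: real
  assumes v_ImH: "v1 \<in> ImH" "v2 \<in> ImH" "v3 \<in> ImH"
    and v_mult: "v1 * v1 = - 1" "v2 * v2 = - 1" "v3 * v3 = - 1"
      "v1 * v2 = v3" "v2 * v3 = v1" "v3 * v1 = v2"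
      "v2 * v1 = - v3" "v3 * v2 = - v1" "v1 * v3 = - v2"
    and edge_ImH [simp]: "M \<in> ImH" "N \<in> ImH" "L \<in> ImH"
    and edges: "q1 - q2 = M" "q2 - q4 = N" "q4 - q1 = L"
    and q3: "q3 = q2 + \<alpha> *\<^sub>R M"
    and q6: "q6 = q4 + \<beta> *\<^sub>R N"
    and q5: "q5 = q1 + \<gamma> *\<^sub>R L"
    and m: "m = apex M N L \<alpha> \<beta> \<gamma>"
    and q7: "(q7 - q1) * m = - (L * (q3 - q5) * M)"
begin

lemma L_eq: "L = - M - N"
  unfolding edges[symmetric] by simp

lemma q_diff:
  "q3 - q2 = \<alpha> *\<^sub>R M" "q3 - q1 = (\<alpha> - 1) *\<^sub>R M"
  "q6 - q4 = \<beta> *\<^sub>R N" "q6 - q2 = (\<beta> - 1) *\<^sub>R N"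
  "q5 - q1 = \<gamma> *\<^sub>R L" "q5 - q4 = (\<gamma> - 1) *\<^sub>R L"
  unfolding q3 q5 q6 edges[symmetric] by (simp_all add: algebra_simps)

lemma q_diff_cross:
  "q3 - q5 = (\<alpha> - 1) *\<^sub>R M - \<gamma> *\<^sub>R L"
  "q6 - q3 = (\<beta> - 1) *\<^sub>R N - \<alpha> *\<^sub>R M"
  "q5 - q6 = (\<gamma> - 1) *\<^sub>R L - \<beta> *\<^sub>R N"
  unfolding q_diff[symmetric] by simp_all

text \<open>This is the difference of the formulas for \<open>(q7 - q1) * m\<close> and
  \<open>(q7 - q2) * m\<close>; being free of \<open>q7\<close>, it is a polynomial identity in the
  sides and the parameters.\<close>

lemma sides_relation: "M * m = L * (q3 - q5) * M - M * (q6 - q3) * N"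
  unfolding q_diff_cross m L_eq apex_def using edge_ImH(1,2)
  by (simp add: quat_eq_iff ImH_iff quat_times_sel inner_quat_def algebra_simps)

lemma q7_q2: "(q7 - q2) * m = - (M * (q6 - q3) * N)"
proof -
  have "(q7 - q2) * m = (q7 - q1) * m + M * m" by (simp add: edges(1)[symmetric] algebra_simps)
  then show ?thesis unfolding q7 sides_relation by simp
qed

text \<open>The index symmetry 1 to 2 to 4 and 3 to 6 to 5. Through it every result about the
  direction \<open>v1\<close> also holds for \<open>v2\<close> and \<open>v3\<close>.\<close>

lemma rotate: "miquel_frame v2 v3 v1 q2 q4 q1 q6 q5 q3 q7 N L M m \<beta> \<gamma> \<alpha>"
proof
  show "m = apex N L M \<beta> \<gamma> \<alpha>"
    unfolding m by (rule apex_rotate[symmetric]) (simp_all add: L_eq)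
  show "(q7 - q2) * m = - (M * (q6 - q3) * N)" by (rule q7_q2)
qed (use v_ImH v_mult edges q3 q5 q6 in auto)

lemma q7_q4: "(q7 - q4) * m = - (N * (q5 - q6) * L)"
  using miquel_frame.q7_q2[OF rotate] .


section \<open>Values of the Hermitian form on pairs of corners\<close>

lemma v_cancel [simp]:
  "v1 * (v1 * x) = - x" "v2 * (v2 * x) = - x" "v3 * (v3 * x) = - x"
  "v1 * (v2 * x) = v3 * x" "v2 * (v3 * x) = v1 * x" "v3 * (v1 * x) = v2 * x"
  "v2 * (v1 * x) = - (v3 * x)" "v3 * (v2 * x) = - (v1 * x)" "v1 * (v3 * x) = - (v2 * x)"
  by (simp_all add: mult.assoc[symmetric] v_mult)

text \<open>Each product \<open>v * x * v\<close> is a reflection, and the three together give 3x -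
  2x = x. The proof uses only the multiplication table, so that \<open>frame_expansion\<close> can
  be deduced from it.\<close>

lemma frame_reflections:
  assumes x: "x \<in> ImH"
  shows "v2 * x * v2 + v3 * x * v3 = x - v1 * x * v1"
proof -
  have "v3 * x * v3 = (v1 * v2) * x * (- (v2 * v1))"
    by (simp only: v_mult(4,7) minus_minus)
  also have "\<dots> = - (v1 * (v2 * x * v2) * v1)"
    by (simp only: mult.assoc mult_minus_right)
  also have "\<dots> = (2 * inner x v2) *\<^sub>R v2 - v1 * x * v1"
    unfolding ImH_reflection[OF v_ImH(2) x v_mult(2)]
    by (simp add: left_diff_distrib right_diff_distrib v_mult)
  finally show ?thesis
    by (simp add: ImH_reflection[OF v_ImH(2) x v_mult(2)])
qed

text \<open>The digits in the names \<open>form_...\<close> are pairs of corners: each left-hand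
  side becomes a coefficient of \<open>hS\<close> in \<open>hS_in_span\<close>. Here the two factors
  parallel to \<open>M\<close> collapse to a real number.\<close>

lemma form_23: "qcnj v2 * (q3 - q2) * (M * v3) = (\<alpha> * inner M M) *\<^sub>R v1"
proof -
  have "qcnj v2 * (q3 - q2) * (M * v3) = - (\<alpha> *\<^sub>R (v2 * (M * M) * v3))"
    by (simp add: q_diff qcnj_ImH v_ImH mult.assoc)
  also have "\<dots> = (\<alpha> * inner M M) *\<^sub>R v1"
    by (simp only: ImH_square edge_ImH) (simp add: v_mult mult.assoc)
  finally show ?thesis .
qed

lemma form_45: "qcnj v3 * (q5 - q4) * (L * v2) = - (((\<gamma> - 1) * inner L L) *\<^sub>R v1)"
proof -
  have "qcnj v3 * (q5 - q4) * (L * v2) = - ((\<gamma> - 1) *\<^sub>R (v3 * (L * L) * v2))"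
    by (simp add: q_diff qcnj_ImH v_ImH mult.assoc)
  also have "\<dots> = - (((\<gamma> - 1) * inner L L) *\<^sub>R v1)"
    by (simp only: ImH_square edge_ImH) (simp add: v_mult mult.assoc)
  finally show ?thesis .
qed

text \<open>Since \<open>v3 = - (v2 * v1)\<close>, the factor \<open>v1\<close> splits off on the
  right and leaves the anticommutator of \<open>M\<close> and \<open>v2\<close>.\<close>

lemma form_03_21: "M * v3 + qcnj v2 * (q1 - q2) * v1 = (2 * inner M v2) *\<^sub>R v1"
proof -
  have "M * v3 + qcnj v2 * (q1 - q2) * v1 = - ((M * v2 + v2 * M) * v1)"
    by (simp add: edges qcnj_ImH v_ImH distrib_right mult.assoc v_mult)
  then show ?thesis by (simp only: ImH_anticommutator edge_ImH v_ImH) simp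
qed

lemma form_05_41: "L * v2 + qcnj v3 * (q1 - q4) * v1 = - ((2 * inner L v3) *\<^sub>R v1)"
proof -
  have "L * v2 + qcnj v3 * (q1 - q4) * v1 = (L * v3 + v3 * L) * v1"
    by (simp add: minus_diff_eq[of q4 q1, symmetric] edges qcnj_ImH v_ImH distrib_right mult.assoc v_mult del: minus_diff_eq)
  then show ?thesis by (simp only: ImH_anticommutator edge_ImH v_ImH) simp
qed

text \<open>The middle factor combines \<open>M\<close> and \<open>N\<close>, so each term contains
  \<open>M * M\<close> or \<open>N * N\<close>, and the product is an imaginary quaternion.\<close>

lemma side_triple:
  "M * (q6 - q3) * N = (\<alpha> * inner M M) *\<^sub>R N - ((\<beta> - 1) * inner N N) *\<^sub>R M"
proof -
  have "M * (q6 - q3) * N = (\<beta> - 1) *\<^sub>R (M * (N * N)) - \<alpha> *\<^sub>R ((M * M) * N)"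
    by (simp add: q_diff_cross right_diff_distrib left_diff_distrib mult.assoc)
  then show ?thesis by (simp only: ImH_square edge_ImH) simp
qed

text \<open>Conjugation reverses a product of three imaginary factors up to sign, and this product
  is itself imaginary by \<open>side_triple\<close>.\<close>

lemma side_triple_rev: "N * (q6 - q3) * M = M * (q6 - q3) * N"
proof -
  have "qcnj (M * (q6 - q3) * N) = - (M * (q6 - q3) * N)"
    unfolding side_triple by (simp add: qcnj_ImH algebra_simps)
  moreover have "qcnj (q6 - q3) = - (q6 - q3)" by (rule qcnj_ImH) (simp add: q_diff_cross)
  ultimately show ?thesis
    by (simp only: qcnj_simps(8) qcnj_ImH[OF edge_ImH(1)] qcnj_ImH[OF edge_ImH(2)])
      (simp only: mult_minus_left mult_minus_right minus_minus mult.assoc neg_equal_iff_equal)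
qed

text \<open>By \<open>q7_q2\<close> the sum becomes \<open>v2 * T - v1 * T * v3\<close>, which is
  \<open>X + qcnj X\<close> times \<open>v1\<close> for \<open>X = v1 * T * v2\<close>.\<close>

lemma form_27_63: "qcnj v2 * (q7 - q2) * m + qcnj (N * v1) * (q3 - q6) * (M * v3) \<in> span {v1}"
proof -
  define T where "T = M * (q6 - q3) * N"
  have T: "qcnj T = - T" unfolding T_def side_triple by (simp add: qcnj_ImH algebra_simps)
  have "qcnj (N * v1) * (q3 - q6) * (M * v3) = - (v1 * (N * (q6 - q3) * M) * v3)"
    by (simp add: qcnj_ImH v_ImH mult.assoc minus_diff_eq[of q6 q3, symmetric] del: minus_diff_eq)
  also have "\<dots> = - (v1 * T * v3)" by (simp only: side_triple_rev T_def)
  finally have "qcnj v2 * (q7 - q2) * m + qcnj (N * v1) * (q3 - q6) * (M * v3) = v2 * T - v1 * T * v3"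
    by (simp only: mult.assoc[of _ "q7 - q2"] q7_q2) (simp add: T_def qcnj_ImH v_ImH)
  also have "\<dots> = (v1 * T * v2 + qcnj (v1 * T * v2)) * v1"
    by (simp add: T qcnj_ImH v_ImH distrib_right left_diff_distrib mult.assoc v_mult)
  also have "\<dots> \<in> span {v1}" by (simp only: add_qcnj) (simp add: scaleR_in_span_singleton)
  finally show ?thesis .
qed

lemma form_47_65: "qcnj v3 * (q7 - q4) * m + qcnj (N * v1) * (q5 - q6) * (L * v2) \<in> span {v1}"
proof -
  define T where "T = N * (q5 - q6) * L"
  have T: "T \<in> ImH"
    using miquel_frame.side_triple[OF rotate] edge_ImH by (simp only: T_def) simp
  have "qcnj (N * v1) * (q5 - q6) * (L * v2) = v1 * T * v2"
    by (simp add: qcnj_ImH v_ImH mult.assoc T_def)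
  then have "qcnj v3 * (q7 - q4) * m + qcnj (N * v1) * (q5 - q6) * (L * v2) = v1 * (v2 * T + T * v2)"
    by (simp only: mult.assoc[of _ "q7 - q4"] q7_q4) (simp add: T_def qcnj_ImH v_ImH distrib_left mult.assoc)
  also have "\<dots> \<in> span {v1}"
    by (simp only: ImH_anticommutator T v_ImH) (simp add: scaleR_in_span_singleton span_neg)
  finally show ?thesis .
qed

text \<open>It suffices that \<open>N * ((q7 - q6) * m)\<close> is real. Passing from
  \<open>q6\<close> to \<open>q2\<close> makes \<open>q7_q2\<close> applicable; the non-real
  remainder \<open>N * M\<close> then meets \<open>M * N\<close> from \<open>m\<close> in an
  anticommutator.\<close>

lemma form_67: "qcnj (N * v1) * (q7 - q6) * m \<in> span {v1}"
proof -
  have qq: "q7 - q6 = (q7 - q2) - (\<beta> - 1) *\<^sub>R N" using q_diff(4) by (simp add: algebra_simps)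
  have "N * ((q7 - q6) * m) = N * ((q7 - q2) * m) - (\<beta> - 1) *\<^sub>R (N * N * m)"
    by (simp add: qq left_diff_distrib right_diff_distrib mult.assoc)
  also have "N * ((q7 - q2) * m) = - (N * (M * (q6 - q3) * N))"
    by (simp only: q7_q2 mult_minus_right)
  also have "N * (M * (q6 - q3) * N) = - ((\<alpha> * inner M M * inner N N) *\<^sub>R 1) - ((\<beta> - 1) * inner N N) *\<^sub>R (N * M)"
    unfolding side_triple by (simp only: right_diff_distrib mult_scaleR_right ImH_square edge_ImH) simp
  also have "N * N * m = - (inner N N *\<^sub>R m)" by (simp only: ImH_square edge_ImH) simp
  finally have "N * ((q7 - q6) * m) = (\<alpha> * inner M M * inner N N) *\<^sub>R 1 + ((\<beta> - 1) * inner N N) *\<^sub>R (N * M + m)"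
    by (simp add: scaleR_add_right)
  also have "N * M + m = ((\<alpha> - 1) * inner M M + (\<beta> - 1) * inner N N + \<gamma> * inner L L) *\<^sub>R 1 + (M * N + N * M)"
    by (simp add: m apex_def)
  also have "M * N + N * M = - ((2 * inner M N) *\<^sub>R 1)" by (rule ImH_anticommutator) simp_all
  also have "(\<alpha> * inner M M * inner N N) *\<^sub>R 1 + ((\<beta> - 1) * inner N N) *\<^sub>R
      (((\<alpha> - 1) * inner M M + (\<beta> - 1) * inner N N + \<gamma> * inner L L) *\<^sub>R 1 + - ((2 * inner M N) *\<^sub>R 1))
      \<in> (\<real> :: quat set)"
    by (simp add: Reals_quat_iff)
  finally obtain r where r: "N * ((q7 - q6) * m) = r *\<^sub>R 1"
    using Reals_eq_scaleR by blast
  have "qcnj (N * v1) * (q7 - q6) * m = v1 * (N * ((q7 - q6) * m))"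
    by (simp add: qcnj_ImH v_ImH mult.assoc)
  then show ?thesis by (simp add: r scaleR_in_span_singleton)
qed

text \<open>The three products of sides and differences are real numbers minus the same imaginary
  \<open>Y\<close>, the imaginary part of \<open>M * N\<close>. The real parts cancel against that
  of \<open>m\<close>, and the reflections of \<open>Y\<close> in the frame add up to a multiple of
  \<open>v1\<close>.\<close>

lemma form_07_25_43_61:
  "m + qcnj v2 * (q5 - q2) * (L * v2) + qcnj v3 * (q3 - q4) * (M * v3)
    + qcnj (N * v1) * (q1 - q6) * v1 \<in> span {v1}"
proof -
  define Y where "Y = M * N + inner M N *\<^sub>R 1"
  have MN: "M * N = Y - inner M N *\<^sub>R 1" by (simp add: Y_def)
  have NM: "N * M = - Y - inner M N *\<^sub>R 1"
  proof -
    have "N * M = - ((2 * inner M N) *\<^sub>R 1) - M * N"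
      using ImH_anticommutator[OF edge_ImH(1,2)] by (metis add_diff_cancel_left')
    then show ?thesis by (simp only: MN) (simp add: quat_eq_iff)
  qed
  have Y: "Y \<in> ImH" unfolding Y_def using edge_ImH by (simp add: ImH_iff quat_times_sel inner_quat_def)
  have sqM: "M * M = - (inner M M *\<^sub>R 1)" and sqN: "N * N = - (inner N N *\<^sub>R 1)" by (simp_all only: ImH_square edge_ImH)
  have pML: "M * L = (inner M M + inner M N) *\<^sub>R 1 - Y"
    by (simp only: L_eq right_diff_distrib mult_minus_right sqM MN) (simp add: algebra_simps)
  have NL: "N * L = (inner N N + inner M N) *\<^sub>R 1 + Y"
    by (simp only: L_eq right_diff_distrib mult_minus_right sqN NM) (simp add: algebra_simps)
  have sqL: "L * L = - (inner L L *\<^sub>R 1)" by (simp only: ImH_square edge_ImH)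
  have 5: "(q5 - q2) * L = (inner M M + inner M N - \<gamma> * inner L L) *\<^sub>R 1 - Y"
  proof -
    have "q5 - q2 = M + \<gamma> *\<^sub>R L" using q_diff(5) edges by (simp add: algebra_simps)
    then show ?thesis by (simp only: distrib_right mult_scaleR_left pML sqL) (simp add: algebra_simps)
  qed
  have 3: "(q3 - q4) * M = - ((inner M N + \<alpha> * inner M M) *\<^sub>R 1) - Y"
  proof -
    have "q3 - q4 = N + \<alpha> *\<^sub>R M" using q_diff(1) edges by (simp add: algebra_simps)
    then show ?thesis by (simp only: distrib_right mult_scaleR_left NM sqM) (simp add: algebra_simps)
  qed
  have 6: "N * (q1 - q6) = (\<beta> * inner N N - inner N N - inner M N) *\<^sub>R 1 - Y"
  proof -
    have "q1 - q6 = - L - \<beta> *\<^sub>R N" unfolding q6 edges(3)[symmetric] by (simp add: algebra_simps)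
    then show ?thesis by (simp only: right_diff_distrib mult_minus_right mult_scaleR_right NL sqN) (simp add: algebra_simps)
  qed
  have "m + qcnj v2 * (q5 - q2) * (L * v2) + qcnj v3 * (q3 - q4) * (M * v3) + qcnj (N * v1) * (q1 - q6) * v1
     = m - v2 * ((q5 - q2) * L) * v2 - v3 * ((q3 - q4) * M) * v3 + v1 * (N * (q1 - q6)) * v1"
    by (simp add: qcnj_ImH v_ImH mult.assoc)
  also have "\<dots> = Y + (v2 * Y * v2 + v3 * Y * v3) - v1 * Y * v1"
    unfolding 5 3 6 m apex_def MN
    by (simp add: left_diff_distrib right_diff_distrib distrib_left distrib_right v_mult)
      (simp add: scaleR_add_left scaleR_diff_left)
  also have "\<dots> = (4 * inner Y v1) *\<^sub>R v1"
    unfolding frame_reflections[OF Y] ImH_reflection[OF v_ImH(1) Y v_mult(1)] by (simp add: scaleR_add_left[symmetric])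
  finally show ?thesis by (simp add: scaleR_in_span_singleton)
qed

end

section \<open>Isotropic cubes\<close>

definition lerp :: "real \<Rightarrow> 'a :: real_vector \<Rightarrow> 'a \<Rightarrow> 'a" where
  "lerp x a b = (1 - x) *\<^sub>R a + x *\<^sub>R b"

lemma lerp_01 [simp]: "lerp 0 a b = a" "lerp 1 a b = b"
  by (simp_all add: lerp_def)

lemma fst_lerp: "fst (lerp x a b) = lerp x (fst a) (fst b)"
  and snd_lerp: "snd (lerp x a b) = lerp x (snd a) (snd b)"
  by (simp_all add: lerp_def)

definition trilin :: "(nat \<Rightarrow> 'a :: real_vector) \<Rightarrow> real \<Rightarrow> real \<Rightarrow> real \<Rightarrow> 'a" where
  "trilin c s t u = (\<Sum>i\<le>1. \<Sum>j\<le>1. \<Sum>k\<le>1.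
     (Bernstein 1 i s * Bernstein 1 j t * Bernstein 1 k u) *\<^sub>R c (i + 2 * j + 4 * k))"

lemma sum_atMost_1: "(\<Sum>i\<le>1. f i) = f 0 + f (1 :: nat)"
  by (simp add: atMost_Suc add.commute)

lemma Bernstein_1 [simp]: "Bernstein 1 0 x = 1 - x" "Bernstein 1 1 x = x"
  by (simp_all add: Bernstein_def)

lemma trilin_lerp:
  "trilin c s t u = lerp s (lerp t (lerp u (c 0) (c 4)) (lerp u (c 2) (c 6)))
    (lerp t (lerp u (c 1) (c 5)) (lerp u (c 3) (c 7)))"
  unfolding trilin_def sum_atMost_1 Bernstein_1
  by (simp add: lerp_def scaleR_add_right mult.assoc numeral_2_eq_2 numeral_3_eq_3)

lemma fst_trilin: "fst (trilin z s t u) = trilin (\<lambda>n. fst (z n)) s t u"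
  and snd_trilin: "snd (trilin z s t u) = trilin (\<lambda>n. snd (z n)) s t u"
  by (simp_all add: trilin_lerp fst_lerp snd_lerp)

text \<open>The index permutation \<open>i + 2j + 4k \<mapsto> j + 2k + 4i\<close> induced by the cyclic shift of the
  parameters.\<close>
definition cyc :: "(nat \<Rightarrow> 'a) \<Rightarrow> nat \<Rightarrow> 'a" where
  "cyc c n = c (2 * (n mod 4) + n div 4)"

lemma cyc_simps [simp]:
  "cyc c 0 = c 0" "cyc c 1 = c 2" "cyc c (Suc 0) = c 2" "cyc c 2 = c 4" "cyc c 3 = c 6"
  "cyc c 4 = c 1" "cyc c 5 = c 3" "cyc c 6 = c 5" "cyc c 7 = c 7"
  by (simp_all add: cyc_def)

lemma trilin_cyc: "trilin z s t u = trilin (cyc z) t u s"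
  by (simp add: trilin_lerp lerp_def algebra_simps)

lemma trilin_step: "trilin z s t u = lerp s (trilin z 0 t u) (trilin z 1 t u)"
  by (simp add: trilin_lerp)

lemma trilin_corner:
  "i \<in> {0,1} \<Longrightarrow> j \<in> {0,1} \<Longrightarrow> k \<in> {0,1} \<Longrightarrow> trilin z (real i) (real j) (real k) = z (i + 2 * j + 4 * k)"
  by (auto simp: trilin_lerp) (simp_all add: numeral_2_eq_2 numeral_3_eq_3)

lemma trilinear_poly_trilin: "trilinear_poly (trilin c)"
proof -
  \<comment> \<open>The monomial coefficients are the iterated differences of the corner
    values.\<close>
  define d where "d i j k =
    (if i = 0 then if j = 0 then if k = 0 then c 0 else c 4 - c 0
       else if k = 0 then c 2 - c 0 else c 6 - c 4 - c 2 + c 0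
     else if j = 0 then if k = 0 then c 1 - c 0 else c 5 - c 4 - c 1 + c 0
       else if k = 0 then c 3 - c 2 - c 1 + c 0
         else c 7 - c 6 - c 5 - c 3 + c 4 + c 2 + c 1 - c 0)" for i j k :: nat
  have "trilin c s t u = (\<Sum>i\<le>1. \<Sum>j\<le>1. \<Sum>k\<le>1. (s ^ i * t ^ j * u ^ k) *\<^sub>R d i j k)" for s t u
    unfolding sum_atMost_1 by (simp add: d_def trilin_lerp lerp_def algebra_simps)
  then show ?thesis unfolding trilinear_poly_def by blast
qed

lemma trilinear_polyE:
  assumes "trilinear_poly U"
  obtains c where "U = trilin c"
proof -
  obtain d where d: "U s t u = (\<Sum>i\<le>1. \<Sum>j\<le>1. \<Sum>k\<le>1. (s ^ i * t ^ j * u ^ k) *\<^sub>R d i j k)" for s t u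
    using assms unfolding trilinear_poly_def by blast
  define c where "c n = U (real (n mod 2)) (real (n div 2 mod 2)) (real (n div 4))" for n
  have c: "c 0 = U 0 0 0" "c 1 = U 1 0 0" "c 2 = U 0 1 0" "c 3 = U 1 1 0"
    "c 4 = U 0 0 1" "c 5 = U 1 0 1" "c 6 = U 0 1 1" "c 7 = U 1 1 1"
    by (simp_all add: c_def)
  have 1: "U s t u = lerp s (U 0 t u) (U 1 t u)" and 2: "U s t u = lerp t (U s 0 u) (U s 1 u)"
    and 3: "U s t u = lerp u (U s t 0) (U s t 1)" for s t u
    unfolding d sum_atMost_1 by (simp_all add: lerp_def algebra_simps)
  have "U s t u = trilin c s t u" for s t u
    unfolding trilin_lerp c 1[of s t u] 2[of 0 t u] 2[of 1 t u] 3[of 0 0 u] 3[of 0 1 u] 3[of 1 0 u] 3[of 1 1 u] ..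
  then have "U = trilin c" by (intro ext)
  then show ?thesis using that by blast
qed

text \<open>In homogeneous coordinates \<open>(U, W)\<close> the imaginary quaternions and \<open>\<infinity>\<close> form the isotropic
  cone of this Hermitian form.\<close>
definition hform :: "quat \<times> quat \<Rightarrow> quat \<times> quat \<Rightarrow> quat" where
  "hform z z' = qcnj (snd z) * fst z' + qcnj (fst z) * snd z'"

lemma hform_left: "hform (a + b) c = hform a c + hform b c" "hform (r *\<^sub>R a) c = r *\<^sub>R hform a c"
  and hform_right: "hform c (a + b) = hform c a + hform c b" "hform c (r *\<^sub>R a) = r *\<^sub>R hform c a"
  by (simp_all add: hform_def algebra_simps)

lemma hform_diff_right: "hform c (a - b) = hform c a - hform c b"
  by (simp add: hform_def algebra_simps)

lemma qcnj_hform: "qcnj (hform a b) = hform b a"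
  by (simp add: hform_def)

lemma hform_flip: "qRe (hform a b) = 0 \<Longrightarrow> hform b a = - hform a b"
  by (metis qcnj_hform qcnj_ImH ImH_iff)

lemma hform_self: "hform a a = qRe (hform a a) *\<^sub>R 1"
  by (rule Reals_eq_scaleR) (simp add: Reals_iff_qcnj qcnj_hform)

text \<open>The cross terms are conjugate to each other. Hence an edge between isotropic points is
  isotropic as soon as \<open>hform a b\<close> is imaginary.\<close>

lemma hform_lerp_self:
  "hform (lerp x a b) (lerp x a b)
    = ((1 - x) * (1 - x)) *\<^sub>R hform a a + (x * x) *\<^sub>R hform b b + (2 * x * (1 - x) * qRe (hform a b)) *\<^sub>R 1"
proof -
  have "hform (lerp x a b) (lerp x a b)
    = ((1 - x) * (1 - x)) *\<^sub>R hform a a + (x * x) *\<^sub>R hform b b + (x * (1 - x)) *\<^sub>R (hform a b + qcnj (hform a b))"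
    by (simp add: lerp_def hform_left hform_right qcnj_hform scaleR_add_right mult.commute)
  then show ?thesis by (simp add: add_qcnj mult_ac)
qed

definition hproj :: "quat \<times> quat \<Rightarrow> hquat" where
  "hproj z = qfrac (fst z) (snd z)"

lemma fin_part_hproj: "fin_part (hproj z) = fst z * inverse (snd z)"
  by (simp add: hproj_def qfrac_def)

lemma hproj_eq_Infty_iff: "hproj z = Infty \<longleftrightarrow> snd z = 0"
  by (simp add: hproj_def qfrac_def)

text \<open>Both the real part of \<open>U * inverse W\<close> and the real number
  \<open>hform z z\<close> are multiples of \<open>inner U W\<close>; for \<open>W = 0\<close> the
  form vanishes and the point is \<open>Infty\<close>.\<close>

lemma hproj_in_hatR3_iff: "hproj z \<in> hatR3 \<longleftrightarrow> hform z z = 0"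
proof (cases "snd z = 0")
  case True
  then show ?thesis by (simp add: hproj_def qfrac_def hatR3_def hform_def)
next
  case False
  have "hproj z \<in> hatR3 \<longleftrightarrow> qRe (fst z * inverse (snd z)) = 0"
    using False by (auto simp: hproj_def qfrac_def hatR3_def ImH_iff)
  also have "qRe (fst z * inverse (snd z)) = inner (fst z) (snd z) / inner (snd z) (snd z)"
    by (simp add: inverse_quat_def quat_times_sel inner_quat_def field_simps)
  also have "\<dots> = 0 \<longleftrightarrow> inner (fst z) (snd z) = 0" using False by simp
  also have "\<dots> \<longleftrightarrow> 2 * inner (fst z) (snd z) = 0" by simp
  also have "2 * inner (fst z) (snd z) = qRe (hform z z)"
    by (simp add: hform_def quat_times_sel inner_quat_def algebra_simps)
  also have "\<dots> = 0 \<longleftrightarrow> hform z z = 0"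
    using hform_self[of z] by (metis scaleR_zero_left quat_zero_sel(1))
  finally show ?thesis .
qed

section \<open>Partial derivatives of isotropic cubes\<close>

lemma hform_edge:
  assumes "hform a a = 0" "hform b b = 0" "qRe (hform a b) = 0"
  shows "hform (lerp x a b) (b - a) = hform a b"
proof -
  have "hform (lerp x a b) (b - a) = (1 - x) *\<^sub>R hform a b - x *\<^sub>R hform b a"
    by (simp add: lerp_def hform_left hform_diff_right assms(1,2))
  then show ?thesis by (simp add: hform_flip[OF assms(3)] scaleR_add_left[symmetric])
qed

lemma edge_derivative:
  assumes iso: "hform a a = 0" "hform b b = 0" "qRe (hform a b) = 0"
    and x: "x \<in> {0..1}" and W: "W = snd (lerp x a b)" "W \<noteq> 0"
    and f: "\<And>y. y \<in> {0..1} \<Longrightarrow> f y = hproj (lerp y a b)"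
  shows "vector_derivative (\<lambda>y. fin_part (f y)) (at x within {0..1}) = inverse (qcnj W) * hform a b * inverse W"
proof -
  define U where "U = fst (lerp x a b)"
  have "((\<lambda>y. fst (lerp y a b)) has_vector_derivative fst (b - a)) (at x within {0..1})"
    and "((\<lambda>y. snd (lerp y a b)) has_vector_derivative snd (b - a)) (at x within {0..1})"
    unfolding lerp_def by (auto intro!: derivative_eq_intros simp: has_vector_derivative_def fun_eq_iff algebra_simps)
  note d = this[unfolded has_vector_derivative_def]
  have "((\<lambda>y. fst (lerp y a b) * inverse (snd (lerp y a b))) has_vector_derivative
      (fst (b - a) * inverse W - U * (inverse W * snd (b - a) * inverse W))) (at x within {0..1})"
    unfolding has_vector_derivative_def
    by (rule has_derivative_eq_rhs[OF has_derivative_mult[OF d(1) Deriv.has_derivative_inverse[OF _ d(2)]]])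
      (use W in \<open>auto simp: U_def fun_eq_iff algebra_simps\<close>)
  also have "fst (b - a) * inverse W - U * (inverse W * snd (b - a) * inverse W)
    = inverse (qcnj W) * hform a b * inverse W"
  proof -
    have "hform (lerp x a b) (lerp x a b) = 0" by (simp add: hform_lerp_self iso)
    then have "qcnj W * U + qcnj U * W = 0" by (simp add: hform_def U_def W)
    then have "qcnj U * W * inverse W = - (qcnj W * U) * inverse W" by (simp add: add_eq_0_iff2)
    \<comment> \<open>Isotropy of the point turns the conjugate of \<open>U\<close> into an
      expression in \<open>U\<close> and \<open>W\<close>, so the numerator of the quotient rule
      becomes a value of the form.\<close>
    then have U: "qcnj U = - (qcnj W * U * inverse W)" using W(2) by (simp add: mult.assoc)
    have "hform a b = qcnj W * fst (b - a) + qcnj U * snd (b - a)"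
      unfolding hform_edge[OF iso, symmetric, of x] by (simp add: hform_def U_def W)
    then have "hform a b = qcnj W * (fst (b - a) - U * inverse W * snd (b - a))"
      by (simp add: U right_diff_distrib mult.assoc)
    then have "inverse (qcnj W) * hform a b = fst (b - a) - U * inverse W * snd (b - a)"
      using W(2) by (simp add: mult.assoc[symmetric])
    then show ?thesis by (simp add: left_diff_distrib mult.assoc)
  qed
  finally have "((\<lambda>y. fin_part (f y)) has_vector_derivative (inverse (qcnj W) * hform a b * inverse W)) (at x within {0..1})"
    by (rule has_vector_derivative_transform[rotated 2]) (use x f in \<open>auto simp: fin_part_hproj\<close>)
  then show ?thesis
    using vector_derivative_within_cbox[of 0 1 x] x by simp
qed

text \<open>Up to the factors \<open>W\<close> this is the partial derivative in the direction \<open>s\<close>; isotropy makes it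
  independent of \<open>s\<close>. The other two directions are obtained from the shifts of \<open>z\<close>.\<close>
definition hS :: "(nat \<Rightarrow> quat \<times> quat) \<Rightarrow> real \<Rightarrow> real \<Rightarrow> quat" where
  "hS z t u = hform (trilin z 0 t u) (trilin z 1 t u)"

definition isotropic_cube :: "(nat \<Rightarrow> quat \<times> quat) \<Rightarrow> bool" where
  "isotropic_cube z \<longleftrightarrow> (\<forall>s\<in>{0..1}. \<forall>t\<in>{0..1}. \<forall>u\<in>{0..1}. hform (trilin z s t u) (trilin z s t u) = 0)"

lemma isotropic_cube_cyc: "isotropic_cube (cyc z) \<longleftrightarrow> isotropic_cube z"
  unfolding isotropic_cube_def trilin_cyc[of z] by blast

lemma isotropic_edge:
  assumes "hform a a = 0" "hform b b = 0" "hform (lerp (1/2) a b) (lerp (1/2) a b) = 0"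
  shows "qRe (hform a b) = 0"
  using assms(3) unfolding hform_lerp_self by (simp add: assms quat_eq_iff)

lemma hS_imaginary:
  assumes "isotropic_cube z" "t \<in> {0..1}" "u \<in> {0..1}"
  shows "qRe (hS z t u) = 0"
  unfolding hS_def
proof (rule isotropic_edge)
  show "hform (lerp (1/2) (trilin z 0 t u) (trilin z 1 t u)) (lerp (1/2) (trilin z 0 t u) (trilin z 1 t u)) = 0"
    unfolding trilin_step[symmetric] using assms unfolding isotropic_cube_def by simp
qed (use assms in \<open>auto simp: isotropic_cube_def\<close>)

definition agrees :: "(real \<Rightarrow> real \<Rightarrow> real \<Rightarrow> hquat) \<Rightarrow> (nat \<Rightarrow> quat \<times> quat) \<Rightarrow> bool" where
  "agrees F z \<longleftrightarrow> (\<forall>s\<in>{0..1}. \<forall>t\<in>{0..1}. \<forall>u\<in>{0..1}. F s t u = hproj (trilin z s t u))"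

text \<open>Since \<open>cyc\<close> moves the next parameter into first position, one computation
  for the first parameter serves all three directions.\<close>

lemma
  assumes z: "isotropic_cube z" "agrees F z"
    and stu: "s \<in> {0..1}" "t \<in> {0..1}" "u \<in> {0..1}"
    and W: "W = snd (trilin z s t u)" "W \<noteq> 0"
  shows pd_s_eq: "pd_s F s t u = inverse (qcnj W) * hS z t u * inverse W"
    and pd_t_eq: "pd_t F s t u = inverse (qcnj W) * hS (cyc z) u s * inverse W"
    and pd_u_eq: "pd_u F s t u = inverse (qcnj W) * hS (cyc (cyc z)) s t * inverse W"
proof -
  have main: "vector_derivative (\<lambda>y. fin_part (f y)) (at x within {0..1}) = inverse (qcnj W) * hS z a b * inverse W"
    if "isotropic_cube z" "x \<in> {0..1}" "a \<in> {0..1}" "b \<in> {0..1}"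
      "\<And>y. y \<in> {0..1} \<Longrightarrow> f y = hproj (trilin z y a b)" "W = snd (trilin z x a b)" for f z x a b
    unfolding hS_def
  proof (rule edge_derivative)
    show "qRe (hform (trilin z 0 a b) (trilin z 1 a b)) = 0"
      using hS_imaginary[OF that(1,3,4)] by (simp add: hS_def)
  qed (use that W in \<open>auto simp: isotropic_cube_def trilin_step[symmetric]\<close>)
  show "pd_s F s t u = inverse (qcnj W) * hS z t u * inverse W"
    unfolding pd_s_def by (rule main) (use z stu W in \<open>auto simp: agrees_def\<close>)
  show "pd_t F s t u = inverse (qcnj W) * hS (cyc z) u s * inverse W"
    unfolding pd_t_def
    by (rule main) (use z stu W in \<open>auto simp: agrees_def isotropic_cube_cyc trilin_cyc[of z]\<close>)
  show "pd_u F s t u = inverse (qcnj W) * hS (cyc (cyc z)) s t * inverse W"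
    unfolding pd_u_def
    by (rule main) (use z stu W in \<open>auto simp: agrees_def isotropic_cube_cyc trilin_cyc[of z] trilin_cyc[of "cyc z"]\<close>)
qed

lemma orthogonal_mult_mult:
  "a \<noteq> 0 \<Longrightarrow> b \<noteq> 0 \<Longrightarrow> orthogonal (a * x * b) (a * y * b) \<longleftrightarrow> orthogonal (x :: quat) y"
  by (simp add: orthogonal_def inner_mult_mult)

text \<open>The form of two bilinear interpolations is biquadratic in \<open>t\<close> and
  \<open>u\<close>; the hypotheses concern its nine coefficients in the products of
  \<open>t\<close>, \<open>1 - t\<close>, \<open>u\<close>, \<open>1 - u\<close>.\<close>

lemma hform_bilinear_in_subspace:
  assumes V: "subspace V"
    and "hform a0 b0 \<in> V" "hform a1 b1 \<in> V" "hform a2 b2 \<in> V" "hform a3 b3 \<in> V"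
    and "hform a0 b1 + hform a1 b0 \<in> V" "hform a2 b3 + hform a3 b2 \<in> V"
      "hform a0 b2 + hform a2 b0 \<in> V" "hform a1 b3 + hform a3 b1 \<in> V"
    and "hform a0 b3 + hform a1 b2 + hform a2 b1 + hform a3 b0 \<in> V"
  shows "hform (lerp t (lerp u a0 a2) (lerp u a1 a3)) (lerp t (lerp u b0 b2) (lerp u b1 b3)) \<in> V"
proof -
  define t' u' where "t' = 1 - t" "u' = 1 - u"
  have "hform (lerp t (lerp u a0 a2) (lerp u a1 a3)) (lerp t (lerp u b0 b2) (lerp u b1 b3))
    = (t'*t'*u'*u') *\<^sub>R hform a0 b0 + (t*t*u'*u') *\<^sub>R hform a1 b1 + (t'*t'*u*u) *\<^sub>R hform a2 b2
    + (t*t*u*u) *\<^sub>R hform a3 b3 + (t*t'*u'*u') *\<^sub>R (hform a0 b1 + hform a1 b0)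
    + (t*t'*u*u) *\<^sub>R (hform a2 b3 + hform a3 b2) + (t'*t'*u*u') *\<^sub>R (hform a0 b2 + hform a2 b0)
    + (t*t*u*u') *\<^sub>R (hform a1 b3 + hform a3 b1)
    + (t*t'*u*u') *\<^sub>R (hform a0 b3 + hform a1 b2 + hform a2 b1 + hform a3 b0)"
    unfolding lerp_def t'_u'_def[symmetric]
    by (simp add: hform_left hform_right scaleR_add_right mult_ac)
  also have "\<dots> \<in> V" by (intro subspace_add[OF V] subspace_scale[OF V] assms)
  finally show ?thesis .
qed

text \<open>Isotropy spreads by \<open>hform_lerp_self\<close> from the corners to the edges in
  direction \<open>u\<close>, then to the faces \<open>s = 0\<close> and \<open>s = 1\<close>, and
  finally to the interior.\<close>

lemma isotropic_cubeI:
  assumes "\<And>n. n \<le> 7 \<Longrightarrow> hform (z n) (z n) = 0"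
    and 1: "\<And>t u. qRe (hS z t u) = 0" and 2: "\<And>t u. qRe (hS (cyc z) t u) = 0"
    and 3: "\<And>t u. qRe (hS (cyc (cyc z)) t u) = 0"
  shows "isotropic_cube z"
proof -
  have "hform (trilin (cyc (cyc z)) s t u) (trilin (cyc (cyc z)) s t u) = 0"
    if "t \<in> {0,1}" "u \<in> {0,1}" for s t u
    unfolding trilin_step[of _ s] hform_lerp_self using 3[of t u] that assms(1)
    by (auto simp: hS_def trilin_lerp)
  then have "hform (trilin (cyc z) s t u) (trilin (cyc z) s t u) = 0" if "u \<in> {0,1}" for s t u
    unfolding trilin_step[of _ s] hform_lerp_self using 2[of t u] that
    by (auto simp: hS_def trilin_cyc[of "cyc z"])
  then have "hform (trilin z s t u) (trilin z s t u) = 0" for s t u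
    unfolding trilin_step[of _ s] hform_lerp_self using 1[of t u]
    by (auto simp: hS_def trilin_cyc[of z])
  then show ?thesis by (simp add: isotropic_cube_def)
qed

section \<open>Corner data in inverted coordinates\<close>

lemma hproj_scale:
  assumes "r \<noteq> 0" "g \<noteq> 0"
  shows "hproj (r *\<^sub>R (fst z * g), r *\<^sub>R (snd z * g)) = hproj z"
  using assms by (auto simp: hproj_def qfrac_def inverse_scaleR_distrib nonzero_inverse_mult_distrib mult.assoc)
    (simp add: mult.assoc[symmetric])

text \<open>The inversion at \<open>p\<^sub>0\<close> turns the weights \<open>w\<^sub>n\<close> into \<open>c\<^sub>n = q\<^sub>n\<^sup>-\<^sup>1 w\<^sub>n\<close>, which are polynomial in
  the \<open>q\<^sub>n\<close> and the frame. The form on the corners depends only on these.\<close>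
definition frame_cube :: "(nat \<Rightarrow> quat \<times> quat) \<Rightarrow> (nat \<Rightarrow> quat) \<Rightarrow> (nat \<Rightarrow> quat) \<Rightarrow> bool" where
  "frame_cube z c Q \<longleftrightarrow> (\<forall>n\<in>{1..7}. hform (z 0) (z n) = c n) \<and>
     (\<forall>i\<in>{1..7}. \<forall>j\<in>{1..7}. hform (z i) (z j) = qcnj (c i) * (Q j - Q i) * c j)"

lemma atLeastAtMost_1_7: "{1..7} = {1, 2, 3, 4, 5, 6, 7 :: nat}"
  by auto

lemma frame_cube_cyc:
  assumes "frame_cube z c Q"
  shows "frame_cube (cyc z) (cyc c) (cyc Q)"
proof -
  have *: "cyc f n = f (2 * (n mod 4) + n div 4)" for f :: "nat \<Rightarrow> 'b" and n by (simp add: cyc_def)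
  have "2 * (n mod 4) + n div 4 \<in> {1..7}" if "n \<in> {1..7}" for n :: nat
    using that unfolding atLeastAtMost_1_7 by auto
  then show ?thesis using assms unfolding frame_cube_def * by simp
qed

text \<open>The inversion gives
  \<open>p j - p i = inverse (Q i) * (Q i - Q j) * inverse (Q j)\<close>, whose outer factors cancel
  against the weights; the sign changes because \<open>Q i\<close> is imaginary.\<close>

lemma frame_cube_corners:
  assumes p: "\<And>n. n \<le> 7 \<Longrightarrow> p n \<in> ImH" and ne: "\<And>n. n \<in> {1..7} \<Longrightarrow> p n \<noteq> p 0"
    and Q: "\<And>n. n \<in> {1..7} \<Longrightarrow> Q n = inverse (p n - p 0)"
    and w0: "w 0 = 1" and w: "\<And>n. n \<in> {1..7} \<Longrightarrow> w n = Q n * c n"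
  shows "frame_cube (\<lambda>n. (p n * w n, w n)) c Q"
proof -
  have h: "hform (p i * w i, w i) (p j * w j, w j) = qcnj (w i) * (p j - p i) * w j" if "i \<le> 7" "j \<le> 7" for i j
    using p[OF that(1)] by (simp add: hform_def qcnj_ImH algebra_simps)
  have Qp: "(p n - p 0) * w n = c n" "Q n \<in> ImH" "Q n \<noteq> 0" "p n - p 0 = inverse (Q n)" if "n \<in> {1..7}" for n
    using that Q[OF that] w[OF that] ne[OF that] p[of n] p[of 0] by (auto simp: mult.assoc[symmetric])
  show ?thesis unfolding frame_cube_def
  proof (intro conjI ballI)
    fix n :: nat assume "n \<in> {1..7}"
    then show "hform (p 0 * w 0, w 0) (p n * w n, w n) = c n"
      using h[of 0 n] Qp(1)[of n] by (simp add: w0)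
  next
    fix i j :: nat assume ij: "i \<in> {1..7}" "j \<in> {1..7}"
    have "p j - p i = inverse (Q j) - inverse (Q i)" using Qp(4)[OF ij(1), symmetric] Qp(4)[OF ij(2), symmetric] by simp
    also have "\<dots> = inverse (Q i) * (Q i - Q j) * inverse (Q j)"
      using Qp(3) ij by (simp add: left_diff_distrib right_diff_distrib mult.assoc)
    finally have pp: "p j - p i = inverse (Q i) * (Q i - Q j) * inverse (Q j)" .
    have "qcnj (w i) * (p j - p i) * w j
      = - (qcnj (c i) * (Q i * inverse (Q i)) * (Q i - Q j) * (inverse (Q j) * Q j) * c j)"
      unfolding pp w[OF ij(1)] w[OF ij(2)] by (simp only: qcnj_simps qcnj_ImH Qp(2) ij) (simp only: mult.assoc mult_minus_left mult_minus_right)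
    also have "\<dots> = qcnj (c i) * (Q j - Q i) * c j" using Qp(3) ij by (simp add: left_diff_distrib right_diff_distrib)
    finally show "hform (p i * w i, w i) (p j * w j, w j) = qcnj (c i) * (Q j - Q i) * c j"
      using h[of i j] ij by simp
  qed
qed

context miquel_frame
begin

text \<open>The corners 0, 2, 4, 6 of the face \<open>s = 0\<close> are paired with 1, 3, 5, 7 of
  the opposite face, and the lemmas \<open>form_...\<close> supply the coefficients.\<close>

lemma hS_in_span:
  assumes z: "frame_cube z c Q"
    and c: "c 1 = v1" "c 2 = v2" "c 4 = v3" "c 3 = M * v3" "c 5 = L * v2" "c 6 = N * v1" "c 7 = m"
    and Q: "Q 1 = q1" "Q 2 = q2" "Q 3 = q3" "Q 4 = q4" "Q 5 = q5" "Q 6 = q6" "Q 7 = q7"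
  shows "hS z t u \<in> span {v1}"
proof -
  have h0: "hform (z 0) (z n) = c n" if "n \<in> {1..7}" for n
    using z that unfolding frame_cube_def by blast
  have h: "hform (z n) (z k) = qcnj (c n) * (Q k - Q n) * c k" if "n \<in> {1..7}" "k \<in> {1..7}" for n k
    using z that unfolding frame_cube_def by blast
  have "hform (lerp t (lerp u (z 0) (z 4)) (lerp u (z 2) (z 6))) (lerp t (lerp u (z 1) (z 5)) (lerp u (z 3) (z 7)))
    \<in> span {v1}"
  proof (rule hform_bilinear_in_subspace[OF subspace_span])
    show "hform (z 0) (z 1) \<in> span {v1}" using h0[of 1] c(1) by (simp add: span_base)
    show "hform (z 2) (z 3) \<in> span {v1}" by (simp add: h c Q form_23 scaleR_in_span_singleton)
    show "hform (z 4) (z 5) \<in> span {v1}" by (simp add: h c Q form_45 scaleR_in_span_singleton span_neg)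
    show "hform (z 6) (z 7) \<in> span {v1}" using form_67 by (simp add: h c Q del: qcnj_simps)
    show "hform (z 0) (z 3) + hform (z 2) (z 1) \<in> span {v1}"
      using form_03_21 c(1) Q(1) by (simp add: h0 h c Q scaleR_in_span_singleton)
    show "hform (z 0) (z 5) + hform (z 4) (z 1) \<in> span {v1}"
      using form_05_41 c(1) Q(1) by (simp add: h0 h c Q scaleR_in_span_singleton span_neg)
    show "hform (z 4) (z 7) + hform (z 6) (z 5) \<in> span {v1}"
      using form_47_65 by (simp add: h c Q del: qcnj_simps)
    show "hform (z 2) (z 7) + hform (z 6) (z 3) \<in> span {v1}"
      using form_27_63 by (simp add: h c Q del: qcnj_simps)
    show "hform (z 0) (z 7) + hform (z 2) (z 5) + hform (z 4) (z 3) + hform (z 6) (z 1) \<in> span {v1}"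
      using form_07_25_43_61 c(1) Q(1) by (simp add: h0 h c Q del: qcnj_simps)
  qed
  then show ?thesis by (simp add: hS_def trilin_lerp)
qed

lemma frame_expansion:
  assumes "x \<in> ImH"
  shows "x = inner x v1 *\<^sub>R v1 + inner x v2 *\<^sub>R v2 + inner x v3 *\<^sub>R v3"
proof -
  have "x - (2 * inner x v2) *\<^sub>R v2 + (x - (2 * inner x v3) *\<^sub>R v3) = (2 * inner x v1) *\<^sub>R v1"
    using frame_reflections[OF assms] by (simp add: ImH_reflection assms v_ImH v_mult)
  then have "2 *\<^sub>R x = 2 *\<^sub>R (inner x v1 *\<^sub>R v1 + inner x v2 *\<^sub>R v2 + inner x v3 *\<^sub>R v3)"
    by (simp add: scaleR_add_right algebra_simps scaleR_2)
  then show ?thesis by (simp only: scaleR_cancel_left) simp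
qed

lemma v_nonzero [simp]: "v1 \<noteq> 0" "v2 \<noteq> 0" "v3 \<noteq> 0"
  using v_mult(1-3) by auto

lemma inner_frame: "inner v1 v1 = 1" "inner v2 v2 = 1" "inner v3 v3 = 1"
    "inner v1 v2 = 0" "inner v1 v3 = 0" "inner v2 v3 = 0"
proof -
  have "inner v1 v2 = 0" "inner v1 v3 = 0" "inner v2 v3 = 0"
    using ImH_anticommutator[of v1 v2] ImH_anticommutator[of v1 v3] ImH_anticommutator[of v2 v3]
    by (simp_all add: v_ImH v_mult quat_eq_iff)
  then show "inner v1 v2 = 0" "inner v1 v3 = 0" "inner v2 v3 = 0" .
  show "inner v1 v1 = 1" "inner v2 v2 = 1" "inner v3 v3 = 1"
    using ImH_square[of v1] ImH_square[of v2] ImH_square[of v3]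
    by (simp_all add: v_ImH v_mult quat_eq_iff)
qed

end

text \<open>The conditions on the four corners of a face that follow from isotropy and orthogonality.\<close>
definition orth_face :: "quat \<times> quat \<Rightarrow> quat \<times> quat \<Rightarrow> quat \<times> quat \<Rightarrow> quat \<times> quat \<Rightarrow> bool" where
  "orth_face a b c d \<longleftrightarrow>
     qRe (hform a b) = 0 \<and> qRe (hform c d) = 0 \<and> qRe (hform a c) = 0 \<and> qRe (hform b d) = 0 \<and>
     qRe (hform a d + hform b c) = 0 \<and>
     orthogonal (hform a b) (hform a c) \<and> orthogonal (hform a b) (hform b d) \<and>
     orthogonal (hform c d) (hform a c) \<and> orthogonal (hform c d) (hform b d) \<and>
     orthogonal (hform a b) (hform a d + hform b c) \<and> orthogonal (hform a c) (hform a d + hform c b)"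

text \<open>The end coefficients of the quadratic polynomial in \<open>x\<close> are already
  orthogonal to \<open>e\<close>, so a single interior value of \<open>x\<close> decides about the
  middle one.\<close>

lemma orth_mixed:
  assumes nz: "snd a \<noteq> 0"
    and orth: "\<And>x. x \<in> {0..1} \<Longrightarrow> snd (lerp x a b) \<noteq> 0 \<Longrightarrow> orthogonal e (hform (lerp x a b) (lerp x c d))"
    and "orthogonal e (hform a c)" "orthogonal e (hform b d)"
  shows "orthogonal e (hform a d + hform b c)"
proof -
  \<comment> \<open>The denominator is affine in \<open>x\<close> and nonzero at \<open>a\<close>,
    so it cannot vanish at both 1/2 and 1/3.\<close>
  obtain x :: real where x: "0 < x" "x < 1" "snd (lerp x a b) \<noteq> 0"
  proof (cases "snd (lerp (1/2) a b) = 0")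
    case False
    then show ?thesis using that[of "1/2"] by simp
  next
    case True
    have "snd (lerp (1/3) a b) \<noteq> 0"
    proof
      assume "snd (lerp (1/3) a b) = 0"
      then have "(3 :: real) *\<^sub>R snd (lerp (1/3) a b) - 2 *\<^sub>R snd (lerp (1/2) a b) = 0" using True by simp
      moreover have "(3 :: real) *\<^sub>R snd (lerp (1/3) a b) - 2 *\<^sub>R snd (lerp (1/2) a b) = snd a"
        by (simp add: quat_eq_iff snd_lerp lerp_def field_simps)
      ultimately show False using nz by metis
    qed
    then show ?thesis using that[of "1/3"] by simp
  qed
  have "hform (lerp x a b) (lerp x c d) = ((1-x)*(1-x)) *\<^sub>R hform a c + (x*x) *\<^sub>R hform b d
      + (x*(1-x)) *\<^sub>R (hform a d + hform b c)"
    by (simp add: lerp_def hform_left hform_right scaleR_add_right mult_ac)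
  then have "inner e (hform (lerp x a b) (lerp x c d)) = x * (1 - x) * inner e (hform a d + hform b c)"
    using assms(3,4) by (simp add: orthogonal_def inner_add_right)
  moreover have "inner e (hform (lerp x a b) (lerp x c d)) = 0"
    using orth[of x] x by (simp add: orthogonal_def)
  ultimately show ?thesis using x by (simp add: orthogonal_def)
qed

text \<open>Midpoints of the edges and the centre of the face yield the real-part conditions.
  Orthogonality at the corners and along the two edges at \<open>a\<close> yields the rest.\<close>

lemma orth_faceI:
  fixes a b c d :: "quat \<times> quat"
  defines "P \<equiv> \<lambda>x y. lerp x (lerp y a c) (lerp y b d)"
  assumes iso: "\<And>x y. x \<in> {0..1} \<Longrightarrow> y \<in> {0..1} \<Longrightarrow> hform (P x y) (P x y) = 0"
    and orth: "\<And>x y. x \<in> {0..1} \<Longrightarrow> y \<in> {0..1} \<Longrightarrow> snd (P x y) \<noteq> 0 \<Longrightarrow>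
      orthogonal (hform (P 0 y) (P 1 y)) (hform (P x 0) (P x 1))"
    and nz: "snd a \<noteq> 0" "snd b \<noteq> 0" "snd c \<noteq> 0" "snd d \<noteq> 0"
  shows "orth_face a b c d"
proof -
  have corners: "hform a a = 0" "hform b b = 0" "hform c c = 0" "hform d d = 0"
    using iso[of 0 0] iso[of 1 0] iso[of 0 1] iso[of 1 1] by (simp_all add: P_def)
  have re: "qRe (hform a b) = 0" "qRe (hform c d) = 0" "qRe (hform a c) = 0" "qRe (hform b d) = 0"
    using iso[of "1/2" 0] iso[of "1/2" 1] iso[of 0 "1/2"] iso[of 1 "1/2"]
    by (auto intro!: isotropic_edge corners simp: P_def)
  have "qRe (hform (lerp (1/2) a c) (lerp (1/2) b d)) = 0"
    using iso[of 0 "1/2"] iso[of 1 "1/2"] iso[of "1/2" "1/2"]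
    by (intro isotropic_edge) (simp_all add: P_def)
  moreover have "qRe (hform (lerp (1/2) a c) (lerp (1/2) b d)) =
      (qRe (hform a b) + qRe (hform c d) + qRe (hform a d + hform c b)) / 4"
    by (simp add: lerp_def hform_left hform_right field_simps)
  moreover have "qRe (hform c b) = qRe (hform b c)"
    by (metis qcnj_hform qcnj_sel(1))
  ultimately have mixed: "qRe (hform a d + hform b c) = 0" using re by simp
  have o: "orthogonal (hform a b) (hform a c)" "orthogonal (hform a b) (hform b d)"
     "orthogonal (hform c d) (hform a c)" "orthogonal (hform c d) (hform b d)"
    using orth[of 0 0] orth[of 1 0] orth[of 0 1] orth[of 1 1] nz by (simp_all add: P_def)
  have "orthogonal (hform a b) (hform a d + hform b c)"
    by (rule orth_mixed[OF nz(1) _ o(1,2)]) (use orth[of _ 0] in \<open>simp add: P_def\<close>)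
  moreover have "orthogonal (hform a c) (hform a d + hform c b)"
    by (rule orth_mixed[OF nz(1)])
      (use orth[of 0] o in \<open>auto simp: P_def orthogonal_commute\<close>)
  ultimately show ?thesis using re mixed o by (simp add: orth_face_def)
qed

text \<open>Only the directions \<open>s\<close> and \<open>t\<close> occur; the other two pairs are
  the same condition on the shifts of \<open>z\<close>.\<close>

definition orth_cube :: "(nat \<Rightarrow> quat \<times> quat) \<Rightarrow> bool" where
  "orth_cube z \<longleftrightarrow> (\<forall>s\<in>{0..1}. \<forall>t\<in>{0..1}. \<forall>u\<in>{0..1}.
     snd (trilin z s t u) \<noteq> 0 \<longrightarrow> orthogonal (hS z t u) (hS (cyc z) u s))"

lemma hS_cyc_cyc_cyc: "hS (cyc (cyc (cyc z))) t u = hS z t u"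
  by (simp add: hS_def trilin_lerp)

lemma
  assumes z: "isotropic_cube z" "orth_cube z" and nz: "\<And>n. n \<le> 7 \<Longrightarrow> snd (z n) \<noteq> 0"
  shows orth_face_0123: "orth_face (z 0) (z 1) (z 2) (z 3)"
    and orth_face_4567: "orth_face (z 4) (z 5) (z 6) (z 7)"
proof -
  have P0: "lerp x (lerp y (z 0) (z 2)) (lerp y (z 1) (z 3)) = trilin z x y 0"
    and P1: "lerp x (lerp y (z 4) (z 6)) (lerp y (z 5) (z 7)) = trilin z x y 1" for x y
    by (simp_all add: trilin_lerp)
  have *: "orthogonal (hform (trilin z 0 t u) (trilin z 1 t u)) (hform (trilin z s 0 u) (trilin z s 1 u))"
    if "s \<in> {0..1}" "t \<in> {0..1}" "u \<in> {0..1}" "snd (trilin z s t u) \<noteq> 0" for s t u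
  proof -
    have "hS (cyc z) u s = hform (trilin z s 0 u) (trilin z s 1 u)"
      by (simp add: hS_def trilin_cyc[of z s])
    moreover have "orthogonal (hS z t u) (hS (cyc z) u s)"
      using z(2) that by (simp add: orth_cube_def)
    ultimately show ?thesis by (simp only: hS_def[of z])
  qed
  show "orth_face (z 0) (z 1) (z 2) (z 3)"
    by (rule orth_faceI; (unfold P0)?) (use z(1) nz in \<open>auto intro!: * simp: isotropic_cube_def\<close>)
  show "orth_face (z 4) (z 5) (z 6) (z 7)"
    by (rule orth_faceI; (unfold P1)?) (use z(1) nz in \<open>auto intro!: * simp: isotropic_cube_def\<close>)
qed

section \<open>Uniqueness of the weights\<close>

context miquel_frame
begin

lemma frame_normal:
  assumes "qRe x = 0" "orthogonal x v1" "orthogonal x v2"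
  obtains r where "x = r *\<^sub>R v3"
  using frame_expansion[of x] assms that by (auto simp: ImH_iff orthogonal_def)

lemma inner_v_left:
  "inner (v1 * x) v1 = qRe x" "inner (v2 * x) v2 = qRe x" "qRe (v1 * x) = - inner x v1" "qRe (v2 * x) = - inner x v2"
proof -
  have *: "inner (v * x) v = inner v v * qRe x" "qRe (v * x) = - inner x v" if "v \<in> ImH" for v
    using that by (simp_all add: ImH_iff inner_quat_def quat_times_sel algebra_simps)
  show "inner (v1 * x) v1 = qRe x" "inner (v2 * x) v2 = qRe x" "qRe (v1 * x) = - inner x v1" "qRe (v2 * x) = - inner x v2"
    using *[of v1] *[of v2] by (simp_all add: v_ImH inner_frame)
qed

text \<open>The edges meeting in the fourth corner fix the direction of the weight, the mixed
  conditions its length.\<close>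

lemma face_weight:
  assumes face: "orth_face z0 z1 z2 z3"
    and h: "hform z0 z1 = a *\<^sub>R v1" "hform z0 z2 = b *\<^sub>R v2" "hform z0 z3 = c3"
      "hform z1 z2 = qcnj (a *\<^sub>R v1) * (q2 - q1) * (b *\<^sub>R v2)"
      "hform z2 z1 = qcnj (b *\<^sub>R v2) * (q1 - q2) * (a *\<^sub>R v1)"
      "hform z1 z3 = qcnj (a *\<^sub>R v1) * (q3 - q1) * c3"
      "hform z2 z3 = qcnj (b *\<^sub>R v2) * (q3 - q2) * c3"
    and nz: "a \<noteq> 0" "b \<noteq> 0" "\<alpha> \<noteq> 0" "\<alpha> \<noteq> 1" "M \<noteq> 0"
  shows "c3 = (a * b) *\<^sub>R (M * v3)"
proof -
  define x where "x = inverse M * c3"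
  have c3: "c3 = M * x" using nz by (simp add: x_def mult.assoc[symmetric])
  have MM: "M * (M * y) = - (inner M M *\<^sub>R y)" for y
    by (simp add: mult.assoc[symmetric] ImH_square)
  have h13: "hform z1 z3 = (a * (\<alpha> - 1) * inner M M) *\<^sub>R (v1 * x)"
    unfolding h q_diff c3 by (simp add: qcnj_ImH v_ImH mult.assoc MM)
  have h23: "hform z2 z3 = (b * \<alpha> * inner M M) *\<^sub>R (v2 * x)"
    unfolding h q_diff c3 by (simp add: qcnj_ImH v_ImH mult.assoc MM)
  have "qRe x = 0" "orthogonal x v1" "orthogonal x v2"
  proof -
    have "qRe (hform z1 z3) = 0" "qRe (hform z2 z3) = 0" "inner (hform z0 z1) (hform z1 z3) = 0"
      using face by (simp_all add: orth_face_def orthogonal_def)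
    then show "qRe x = 0" "orthogonal x v1" "orthogonal x v2"
      using nz unfolding h13 h23 h(1)
      by (simp_all add: inner_v_left inner_commute[of v1 "v1 * x"] orthogonal_def)
  qed
  then obtain \<mu> where x: "x = \<mu> *\<^sub>R v3" by (rule frame_normal)
  have e1: "hform z0 z3 + hform z1 z2 = (\<mu> - a * b) *\<^sub>R (M * v3) - (2 * a * b * inner M v1) *\<^sub>R v2"
  proof -
    have "hform z1 z2 = (a * b) *\<^sub>R (v1 * M * v2)"
      unfolding h edges[symmetric] by (simp add: qcnj_ImH v_ImH algebra_simps)
    also have "v1 * M * v2 = (M * v1 + v1 * M) * v2 - M * v3"
      by (simp add: distrib_right mult.assoc v_mult)
    finally show ?thesis
      unfolding h c3 x by (simp only: ImH_anticommutator edge_ImH v_ImH) (simp add: algebra_simps)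
  qed
  have e2: "hform z0 z3 + hform z2 z1 = (\<mu> - a * b) *\<^sub>R (M * v3) + (2 * a * b * inner M v2) *\<^sub>R v1"
  proof -
    have "hform z2 z1 = (a * b) *\<^sub>R (qcnj v2 * (q1 - q2) * v1)"
      unfolding h by (simp add: mult.commute)
    also have "qcnj v2 * (q1 - q2) * v1 = (2 * inner M v2) *\<^sub>R v1 - M * v3"
      using form_03_21 by (simp add: algebra_simps)
    finally show ?thesis
      unfolding h c3 x by (simp add: algebra_simps)
  qed
  have d: "qRe (M * v3) = - inner M v3" "inner v1 (M * v3) = inner M v2" "inner v2 (M * v3) = - inner M v1"
  proof -
    have *: "inner v (M * v3) = - qRe (M * (v3 * v))" "qRe (M * v) = - inner M v" if "v \<in> ImH" for v
      using that v_ImH(3) edge_ImH(1) by (simp_all add: ImH_iff inner_quat_def quat_times_sel algebra_simps)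
    show "qRe (M * v3) = - inner M v3" "inner v1 (M * v3) = inner M v2" "inner v2 (M * v3) = - inner M v1"
      using *[of v1] *[of v2] *[of v3] by (simp_all add: v_ImH v_mult)
  qed
  \<comment> \<open>The mixed conditions annihilate \<open>\<mu> - a * b\<close> times each frame
    component of \<open>M\<close>, and \<open>M\<close> is nonzero.\<close>
  have "(\<mu> - a * b) * inner M v3 = 0" "(\<mu> - a * b) * inner M v2 = 0"
  proof -
    have "qRe (hform z0 z3 + hform z1 z2) = 0" "inner (hform z0 z1) (hform z0 z3 + hform z1 z2) = 0"
      using face by (simp_all only: orth_face_def orthogonal_def)
    then show "(\<mu> - a * b) * inner M v3 = 0" "(\<mu> - a * b) * inner M v2 = 0"
      using nz unfolding e1 h(1)
      by (simp_all add: d inner_diff_right inner_frame v_ImH[unfolded ImH_iff])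
  qed
  moreover have "(\<mu> - a * b) * inner M v1 = 0"
  proof -
    have "inner (hform z0 z2) (hform z0 z3 + hform z2 z1) = 0"
      using face by (simp only: orth_face_def orthogonal_def)
    then show ?thesis
      using nz unfolding e2 h(2)
      by (simp add: d inner_add_right inner_frame inner_commute[of v2 v1])
  qed
  ultimately have "\<mu> = a * b"
    using frame_expansion[OF edge_ImH(1)] nz by auto
  then show ?thesis by (simp add: c3 x)
qed

text \<open>The edges from corners 3 and 5 to corner 7 determine \<open>c7\<close> up to a real
  factor, since \<open>m\<close> satisfies the same conditions by \<open>form_67\<close>. The mixed
  conditions on the face 1, 3, 5, 7 then fix the factor.\<close>

lemma apex_weight:
  assumes face1: "orth_face z1 z3 z5 z7" and face2: "orth_face z2 z6 z3 z7" and face4: "orth_face z4 z5 z6 z7"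
    and h: "hform z1 z3 = qcnj (a *\<^sub>R v1) * (q3 - q1) * ((a * b) *\<^sub>R (M * v3))"
      "hform z1 z5 = qcnj (a *\<^sub>R v1) * (q5 - q1) * ((c * a) *\<^sub>R (L * v2))"
      "hform z2 z3 = qcnj (b *\<^sub>R v2) * (q3 - q2) * ((a * b) *\<^sub>R (M * v3))"
      "hform z4 z5 = qcnj (c *\<^sub>R v3) * (q5 - q4) * ((c * a) *\<^sub>R (L * v2))"
      "hform z3 z7 = qcnj ((a * b) *\<^sub>R (M * v3)) * (q7 - q3) * c7"
      "hform z5 z7 = qcnj ((c * a) *\<^sub>R (L * v2)) * (q7 - q5) * c7"
      "hform z1 z7 = qcnj (a *\<^sub>R v1) * (q7 - q1) * c7"
      "hform z3 z5 = qcnj ((a * b) *\<^sub>R (M * v3)) * (q5 - q3) * ((c * a) *\<^sub>R (L * v2))"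
      "hform z5 z3 = qcnj ((c * a) *\<^sub>R (L * v2)) * (q3 - q5) * ((a * b) *\<^sub>R (M * v3))"
    and nz: "a \<noteq> 0" "b \<noteq> 0" "c \<noteq> 0" "\<alpha> \<noteq> 0" "\<alpha> \<noteq> 1" "\<gamma> \<noteq> 0" "\<gamma> \<noteq> 1" "M \<noteq> 0" "L \<noteq> 0" "q3 \<noteq> q5"
  shows "c7 = (a * b * c) *\<^sub>R m"
proof -
  interpret r: miquel_frame v2 v3 v1 q2 q4 q1 q6 q5 q3 q7 N L M m \<beta> \<gamma> \<alpha> by (rule rotate)
  interpret rr: miquel_frame v3 v1 v2 q4 q1 q2 q5 q3 q6 q7 L M N m \<gamma> \<alpha> \<beta> by (rule r.rotate)
  have m0: "m \<noteq> 0" using q7 nz by auto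
  have sqM: "M * (M * y) = - (inner M M *\<^sub>R y)" and sqL: "L * (L * y) = - (inner L L *\<^sub>R y)" for y
    by (simp_all add: mult.assoc[symmetric] ImH_square)
  have h13: "hform z1 z3 = - ((a * a * b * (\<alpha> - 1) * inner M M) *\<^sub>R v2)"
    unfolding h q_diff by (simp add: qcnj_ImH v_ImH mult.assoc sqM v_mult)
  have h23: "hform z2 z3 = (a * b * b * \<alpha> * inner M M) *\<^sub>R v1"
    unfolding h q_diff by (simp add: qcnj_ImH v_ImH mult.assoc sqM v_mult)
  have h15: "hform z1 z5 = (a * a * c * \<gamma> * inner L L) *\<^sub>R v3"
    unfolding h q_diff by (simp add: qcnj_ImH v_ImH mult.assoc sqL v_mult)
  have h45: "hform z4 z5 = - ((a * c * c * (\<gamma> - 1) * inner L L) *\<^sub>R v1)"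
    unfolding h q_diff by (simp add: qcnj_ImH v_ImH mult.assoc sqL v_mult)
  have h37: "hform z3 z7 = (a * b) *\<^sub>R (v3 * (M * ((q7 - q3) * c7)))"
    unfolding h by (simp add: qcnj_ImH v_ImH mult.assoc)
  have h57: "hform z5 z7 = (c * a) *\<^sub>R (v2 * (L * ((q7 - q5) * c7)))"
    unfolding h by (simp add: qcnj_ImH v_ImH mult.assoc)
  have "qRe (v3 * (M * ((q7 - q3) * c7))) = 0" "orthogonal (v3 * (M * ((q7 - q3) * c7))) v1"
    "orthogonal (v3 * (M * ((q7 - q3) * c7))) v2"
  proof -
    let ?x = "v3 * (M * ((q7 - q3) * c7))"
    have "qRe (hform z3 z7) = 0" "inner (hform z1 z3) (hform z3 z7) = 0" "inner (hform z3 z7) (hform z2 z3) = 0"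
      using face1 face2 by (simp_all only: orth_face_def orthogonal_def)
    then show "qRe ?x = 0" "orthogonal ?x v1" "orthogonal ?x v2"
      using nz unfolding h13 h23 h37 by (simp_all add: orthogonal_def inner_commute[of v2 ?x])
  qed
  then obtain r3 where "v3 * (M * ((q7 - q3) * c7)) = r3 *\<^sub>R v3" by (rule frame_normal)
  then have "v3 * (v3 * (M * ((q7 - q3) * c7))) = v3 * (r3 *\<^sub>R v3)" by (rule arg_cong)
  then have r3: "M * ((q7 - q3) * c7) = r3 *\<^sub>R 1" by (simp add: v_mult)
  have "qRe (v2 * (L * ((q7 - q5) * c7))) = 0" "orthogonal (v2 * (L * ((q7 - q5) * c7))) v1"
    "orthogonal (v2 * (L * ((q7 - q5) * c7))) v3"
  proof -
    let ?x = "v2 * (L * ((q7 - q5) * c7))"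
    have "qRe (hform z5 z7) = 0" "inner (hform z5 z7) (hform z1 z5) = 0" "inner (hform z4 z5) (hform z5 z7) = 0"
      using face1 face4 by (simp_all only: orth_face_def orthogonal_def)
    then show "qRe ?x = 0" "orthogonal ?x v1" "orthogonal ?x v3"
      using nz unfolding h15 h45 h57 by (simp_all add: orthogonal_def inner_commute[of v1 ?x])
  qed
  then obtain r5 where "v2 * (L * ((q7 - q5) * c7)) = r5 *\<^sub>R v2" by (metis rr.frame_normal)
  then have "v2 * (v2 * (L * ((q7 - q5) * c7))) = v2 * (r5 *\<^sub>R v2)" by (rule arg_cong)
  then have r5: "L * ((q7 - q5) * c7) = r5 *\<^sub>R 1" by (simp add: v_mult)
  have "v3 * (M * ((q7 - q3) * m)) \<in> span {v3}"
    using rr.form_67 by (simp add: qcnj_ImH v_ImH mult.assoc)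
  then obtain k3 where "v3 * (M * ((q7 - q3) * m)) = k3 *\<^sub>R v3" by (auto simp: span_singleton)
  then have "v3 * (v3 * (M * ((q7 - q3) * m))) = v3 * (k3 *\<^sub>R v3)" by (rule arg_cong)
  then have k3: "M * ((q7 - q3) * m) = k3 *\<^sub>R 1" by (simp add: v_mult)
  have "v2 * (L * ((q7 - q5) * m)) \<in> span {v2}"
    using r.form_67 by (simp add: qcnj_ImH v_ImH mult.assoc)
  then obtain k5 where "v2 * (L * ((q7 - q5) * m)) = k5 *\<^sub>R v2" by (auto simp: span_singleton)
  then have "v2 * (v2 * (L * ((q7 - q5) * m))) = v2 * (k5 *\<^sub>R v2)" by (rule arg_cong)
  then have k5: "L * ((q7 - q5) * m) = k5 *\<^sub>R 1" by (simp add: v_mult)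
  have cancel: "\<exists>\<kappa>. c7 = \<kappa> *\<^sub>R m" if "X * (Y * c7) = r *\<^sub>R 1" "X * (Y * m) = k *\<^sub>R 1" "X \<noteq> 0" "Y \<noteq> 0" for X Y r k
  proof -
    have "k \<noteq> 0" using that m0 by auto
    then have "X * (Y * (c7 - (r / k) *\<^sub>R m)) = 0" using that(1,2) by (simp add: right_diff_distrib)
    then show ?thesis using that(3,4) by auto
  qed
  \<comment> \<open>If \<open>q7 = q3\<close>, the edge from corner 3 carries no information; the
    edge from corner 5 then does, because \<open>q3 \<noteq> q5\<close>.\<close>
  obtain \<kappa> where \<kappa>: "c7 = \<kappa> *\<^sub>R m"
  proof (cases "q7 = q3")
    case True
    then show ?thesis using cancel[OF r5 k5] nz that by auto
  next
    case False
    then show ?thesis using cancel[OF r3 k3] nz that by auto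
  qed
  define H where "H = qcnj v1 * (q7 - q1) * m"
  define T where "T = L * (q3 - q5) * M"
  have H: "H = v1 * T" by (simp add: H_def T_def qcnj_ImH v_ImH mult.assoc q7)
  have "qcnj v1 * (q7 - q1) * m + qcnj (M * v3) * (q5 - q3) * (L * v2) \<in> span {v3}"
    by (rule rr.form_27_63)
  then obtain k where k: "H + qcnj (M * v3) * (q5 - q3) * (L * v2) = k *\<^sub>R v3"
    by (auto simp: span_singleton H_def)
  have "qcnj v1 * (q7 - q1) * m + qcnj (L * v2) * (q3 - q5) * (M * v3) \<in> span {v2}"
    by (rule r.form_47_65)
  then obtain l where l: "H + qcnj (L * v2) * (q3 - q5) * (M * v3) = l *\<^sub>R v2"
    by (auto simp: span_singleton H_def)
  have "hform z1 z7 = (a * \<kappa>) *\<^sub>R H" unfolding h \<kappa> H_def by (simp add: mult.commute)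
  moreover have "hform z3 z5 = (a * a * b * c) *\<^sub>R (k *\<^sub>R v3 - H)"
    unfolding h k[symmetric] by (simp add: mult_ac)
  moreover have "hform z5 z3 = (a * a * b * c) *\<^sub>R (l *\<^sub>R v2 - H)"
    unfolding h l[symmetric] by (simp add: mult_ac)
  ultimately have e: "hform z1 z7 + hform z3 z5 = (a * (\<kappa> - a * b * c)) *\<^sub>R H + (a * a * b * c * k) *\<^sub>R v3"
    "hform z1 z7 + hform z5 z3 = (a * (\<kappa> - a * b * c)) *\<^sub>R H + (a * a * b * c * l) *\<^sub>R v2"
    by (simp_all add: algebra_simps)
  have "(\<kappa> - a * b * c) * qRe H = 0" "(\<kappa> - a * b * c) * inner H v2 = 0"
  proof -
    have "qRe (hform z1 z7 + hform z3 z5) = 0" "inner (hform z1 z3) (hform z1 z7 + hform z3 z5) = 0"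
      using face1 by (simp_all only: orth_face_def orthogonal_def)
    then show "(\<kappa> - a * b * c) * qRe H = 0" "(\<kappa> - a * b * c) * inner H v2 = 0"
      using nz unfolding e h13
      by (simp_all add: inner_add_right inner_frame inner_commute[of v2 H] v_ImH[unfolded ImH_iff])
  qed
  moreover have "(\<kappa> - a * b * c) * inner H v3 = 0"
  proof -
    have "inner (hform z1 z5) (hform z1 z7 + hform z5 z3) = 0"
      using face1 by (simp only: orth_face_def orthogonal_def)
    then show ?thesis
      using nz unfolding e h15
      by (simp add: inner_add_right inner_frame inner_commute[of v3 H] inner_commute[of v3 v2])
  qed
  \<comment> \<open>If all three numbers vanished, \<open>H = v1 * T\<close> would be a multiple of
    \<open>v1\<close> and \<open>T\<close> real. But \<open>T\<close> is imaginary and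
    nonzero.\<close>
  moreover have False if H0: "qRe H = 0" "inner H v2 = 0" "inner H v3 = 0"
  proof -
    obtain r where "H = r *\<^sub>R v1"
      by (rule r.frame_normal[of H]) (use H0 in \<open>auto simp: orthogonal_def\<close>)
    then have "v1 * (v1 * T) = v1 * (r *\<^sub>R v1)" by (simp add: H)
    then have "T = r *\<^sub>R 1" by (simp add: v_mult)
    moreover have "T \<in> ImH" unfolding T_def rr.side_triple by simp
    ultimately have "T = 0" by (simp add: ImH_iff)
    then show False using nz by (simp add: T_def)
  qed
  ultimately have "\<kappa> = a * b * c" by auto
  then show ?thesis by (simp add: \<kappa>)
qed

end

section \<open>Existence and uniqueness of the cube\<close>

text \<open>Inversion at \<open>a\<close> sends the circle to a line. The parameter avoids 0 and 1
  because \<open>d\<close> differs from \<open>c\<close> and \<open>b\<close>.\<close>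

lemma gen_circle_line_param:
  assumes C: "gen_circle C" "Fin a \<in> C" "Fin b \<in> C" "Fin c \<in> C" "Fin d \<in> C"
    and ImH: "a \<in> ImH" "b \<in> ImH" "c \<in> ImH" "d \<in> ImH"
    and neq: "b \<noteq> a" "c \<noteq> a" "d \<noteq> a" "b \<noteq> c" "d \<noteq> b" "d \<noteq> c"
  obtains k where "k \<noteq> 0" "k \<noteq> 1"
    "inverse (d - a) = inverse (c - a) + k *\<^sub>R (inverse (b - a) - inverse (c - a))"
proof -
  have "(a - b) * (b - c) * (c - d) * (d - a) \<in> \<real>"
    by (rule gen_circle_product_real[OF C])
  then have "(inverse (b - a) - inverse (c - a)) * (inverse (c - a) - inverse (d - a)) \<in> \<real>"
    by (intro product_real_inverse_line) (simp_all add: ImH neq)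
  moreover have ne: "inverse (b - a) \<noteq> inverse (c - a)" "inverse (d - a) \<noteq> inverse (b - a)" "inverse (d - a) \<noteq> inverse (c - a)"
    using neq by (metis diff_add_cancel inverse_inverse_eq)+
  ultimately obtain k where k: "inverse (c - a) - inverse (d - a) = k *\<^sub>R (inverse (b - a) - inverse (c - a))"
    using ImH_parallel[of "inverse (b - a) - inverse (c - a)" "inverse (c - a) - inverse (d - a)"] ImH
    by auto
  then have d: "inverse (d - a) = inverse (c - a) + (- k) *\<^sub>R (inverse (b - a) - inverse (c - a))"
    by (simp add: algebra_simps)
  moreover have "- k \<noteq> 0" "- k \<noteq> 1" using d ne by auto
  ultimately show ?thesis using that by blast
qed

lemma gen_circle_product_real_inverse:
  assumes C: "gen_circle C" "Fin a \<in> C" "Fin b \<in> C" "Fin c \<in> C" "Fin d \<in> C"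
    and ImH: "a \<in> ImH" "b \<in> ImH" "c \<in> ImH" "d \<in> ImH" "e \<in> ImH"
    and neq: "a \<noteq> e" "b \<noteq> e" "c \<noteq> e" "d \<noteq> e"
  shows "(inverse (a - e) - inverse (b - e)) * (inverse (b - e) - inverse (c - e))
    * (inverse (c - e) - inverse (d - e)) * (inverse (d - e) - inverse (a - e)) \<in> \<real>"
  by (rule product_real_inverse) (use gen_circle_product_real[OF C] ImH neq in auto)

lemma quaternion_frame:
  assumes "v1 \<in> ImH" "v2 \<in> ImH" "norm v1 = 1" "norm v2 = 1" "orthogonal v1 v2" "v3 = v1 * v2"
  shows "v1 * v1 = - 1" "v2 * v2 = - 1" "v3 * v3 = - 1" "v1 * v2 = v3" "v2 * v3 = v1" "v3 * v1 = v2"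
    "v2 * v1 = - v3" "v3 * v2 = - v1" "v1 * v3 = - v2"
proof -
  show 1: "v1 * v1 = - 1" and 2: "v2 * v2 = - 1"
    using assms by (simp_all add: ImH_square dot_square_norm)
  show 21: "v2 * v1 = - v3"
    using orthogonal_anticommute[of v1 v2] assms by (simp add: orthogonal_def)
  show "v1 * v2 = v3" by (simp add: assms)
  show 13: "v1 * v3 = - v2" by (simp add: assms(6) mult.assoc[symmetric] 1)
  show 32: "v3 * v2 = - v1" by (simp add: assms(6) mult.assoc 2)
  have "v3 = - (v2 * v1)" by (simp add: 21)
  then show 31: "v3 * v1 = v2" by (simp add: mult.assoc 1)
  have "v2 * v3 = - (v2 * (v2 * v1))" by (simp add: 21)
  then show "v2 * v3 = v1" by (simp add: mult.assoc[symmetric] 2)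
  have "v3 * v3 = v3 * (v1 * v2)" by (simp add: assms(6))
  then show "v3 * v3 = - 1" by (simp add: mult.assoc[symmetric] 31 2)
qed

lemma orthogonal_span_singletons:
  "orthogonal v w \<Longrightarrow> x \<in> span {v} \<Longrightarrow> y \<in> span {w} \<Longrightarrow> orthogonal x y"
  by (auto simp: span_singleton orthogonal_def)

lemma span_ImH: "v \<in> ImH \<Longrightarrow> x \<in> span {v} \<Longrightarrow> qRe x = 0"
  by (auto simp: span_singleton ImH_iff)

lemma det_im_vec:
  assumes "v1 \<in> ImH" "v2 \<in> ImH" "v3 \<in> ImH"
  shows "det (vector [im_vec v1, im_vec v2, im_vec v3] :: real ^ 3 ^ 3) = inner (v1 * v2) v3"
  using assms by (simp add: det_3 im_vec_def inner_quat_def quat_times_sel ImH_iff algebra_simps)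

lemma dc_cubeI:
  assumes iso: "isotropic_cube z" and F: "agrees F z"
    and span: "\<And>t u. hS z t u \<in> span {v1}" "\<And>t u. hS (cyc z) t u \<in> span {v2}"
      "\<And>t u. hS (cyc (cyc z)) t u \<in> span {v3}"
    and base: "snd (z 0) = 1" "hform (z 0) (z 1) = v1" "hform (z 0) (z 2) = v2" "hform (z 0) (z 4) = v3"
    and v: "v1 \<in> ImH" "v2 \<in> ImH" "v3 \<in> ImH" "norm v1 = 1" "norm v2 = 1" "norm v3 = 1"
      "orthogonal v1 v2" "orthogonal v1 v3" "orthogonal v2 v3" "v3 = v1 * v2"
  shows "dc_cube F" "has_frame F v1 v2 v3"
proof -
  have F': "F s t u = hproj (trilin z s t u)" if "s \<in> {0..1}" "t \<in> {0..1}" "u \<in> {0..1}" for s t u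
    using F that by (simp add: agrees_def)
  have z0: "trilin z 0 0 0 = z 0" by (simp add: trilin_lerp)
  have pd0: "pd_s F 0 0 0 = v1" "pd_t F 0 0 0 = v2" "pd_u F 0 0 0 = v3"
    using pd_s_eq[OF iso F, of 0 0 0 1] pd_t_eq[OF iso F, of 0 0 0 1] pd_u_eq[OF iso F, of 0 0 0 1]
    by (simp_all add: z0 base base(2)[unfolded One_nat_def] hS_def trilin_lerp)
  have sgn: "sgn x = x" if "norm x = 1" for x :: quat using that by (simp add: sgn_div_norm)
  show "has_frame F v1 v2 v3"
    using v by (simp add: has_frame_def pd0 sgn)
  have hat: "F s t u \<in> hatR3" if "s \<in> {0..1}" "t \<in> {0..1}" "u \<in> {0..1}" for s t u
    using iso that by (simp add: F' hproj_in_hatR3_iff isotropic_cube_def)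
  have tri: "\<exists>U W. trilinear_poly U \<and> trilinear_poly W \<and>
        (\<forall>s\<in>{0..1}. \<forall>t\<in>{0..1}. \<forall>u\<in>{0..1}. F s t u = qfrac (U s t u) (W s t u))"
    by (intro exI[of _ "trilin (\<lambda>n. fst (z n))"] exI[of _ "trilin (\<lambda>n. snd (z n))"])
      (simp add: trilinear_poly_trilin F' hproj_def fst_trilin snd_trilin)
  have orth: "orthogonal (pd_s F s t u) (pd_t F s t u) \<and>
        orthogonal (pd_s F s t u) (pd_u F s t u) \<and>
        orthogonal (pd_t F s t u) (pd_u F s t u)"
    if stu: "s \<in> {0..1}" "t \<in> {0..1}" "u \<in> {0..1}" and fin: "F s t u \<noteq> Infty" for s t u
  proof -
    have W: "snd (trilin z s t u) \<noteq> 0" using fin stu by (simp add: F' hproj_eq_Infty_iff)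
    show ?thesis
      unfolding pd_s_eq[OF iso F stu refl W] pd_t_eq[OF iso F stu refl W] pd_u_eq[OF iso F stu refl W]
      using W v(7-9) span by (auto simp: orthogonal_mult_mult intro: orthogonal_span_singletons)
  qed
  \<comment> \<open>At this corner the denominator is 1, so the derivatives are the frame itself and
    the determinant is \<open>inner v3 v3 = 1\<close>.\<close>
  have jac: "F 0 0 0 \<noteq> Infty \<and> jacobian F 0 0 0 \<noteq> 0"
    using v det_im_vec[of v1 v2 v3] by (simp add: F' z0 hproj_eq_Infty_iff base jacobian_def pd0 dot_square_norm)
  show "dc_cube F"
    unfolding dc_cube_def
  proof (intro conjI)
    have "(0 :: real) \<in> {0..1}" by simp
    then show "\<exists>s\<in>{0..1}. \<exists>t\<in>{0..1}. \<exists>u\<in>{0..1}. F s t u \<noteq> Infty \<and> jacobian F s t u \<noteq> 0"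
      using jac by blast
  qed (use hat tri orth in blast)+
qed

section \<open>Homogeneous coordinates of a given cube and changes of parameter\<close>

lemma has_cornersD:
  assumes "has_corners F p" "n \<le> 7"
  shows "F (real (n mod 2)) (real (n div 2 mod 2)) (real (n div 4)) = Fin (p n)"
proof -
  have n: "n mod 2 + 2 * (n div 2 mod 2) + 4 * (n div 4) = n"
    and "n div 4 < 2" using assms(2) by presburger+
  moreover have "n mod 2 < 2" "n div 2 mod 2 < 2" by simp_all
  ultimately have "n mod 2 \<in> {0,1}" "n div 2 mod 2 \<in> {0,1}" "n div 4 \<in> {0,1}" by auto
  then show ?thesis using assms(1) unfolding has_corners_def by (metis n)
qed

lemma trilin_corner_bits:
  assumes "n \<le> 7"
  shows "trilin z (real (n mod 2)) (real (n div 2 mod 2)) (real (n div 4)) = z n"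
proof -
  have n: "n mod 2 + 2 * (n div 2 mod 2) + 4 * (n div 4) = n"
    and "n div 4 < 2" using assms by presburger+
  moreover have "n mod 2 < 2" "n div 2 mod 2 < 2" by simp_all
  ultimately have "n mod 2 \<in> {0,1}" "n div 2 mod 2 \<in> {0,1}" "n div 4 \<in> {0,1}" by auto
  then show ?thesis using trilin_corner n by metis
qed

lemma dc_cube_coordinates:
  assumes G: "dc_cube G" "has_corners G p"
  obtains w where "w 0 = 1" "\<And>n. n \<le> 7 \<Longrightarrow> w n \<noteq> 0" "agrees G (\<lambda>n. (p n * w n, w n))"
    "isotropic_cube (\<lambda>n. (p n * w n, w n))" "orth_cube (\<lambda>n. (p n * w n, w n))"
    "orth_cube (cyc (\<lambda>n. (p n * w n, w n)))" "orth_cube (cyc (cyc (\<lambda>n. (p n * w n, w n))))"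
proof -
  obtain U W where UW: "trilinear_poly U" "trilinear_poly W"
    and GUW: "\<And>s t u. s \<in> {0..1} \<Longrightarrow> t \<in> {0..1} \<Longrightarrow> u \<in> {0..1} \<Longrightarrow> G s t u = qfrac (U s t u) (W s t u)"
    using G(1) unfolding dc_cube_def by blast
  obtain cU cW where c: "U = trilin cU" "W = trilin cW" using UW by (metis trilinear_polyE)
  have corner: "cW n \<noteq> 0 \<and> cU n = p n * cW n" if "n \<le> 7" for n
  proof -
    have "G (real (n mod 2)) (real (n div 2 mod 2)) (real (n div 4)) = qfrac (cU n) (cW n)"
      using GUW[of "real (n mod 2)" "real (n div 2 mod 2)" "real (n div 4)"] that
      by (simp add: c trilin_corner_bits) 
    then have "qfrac (cU n) (cW n) = Fin (p n)" using has_cornersD[OF G(2) that] by simp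
    then have "cW n \<noteq> 0" "p n = cU n * inverse (cW n)" by (auto simp: qfrac_def split: if_splits)
    then show ?thesis by (simp add: mult.assoc)
  qed
  \<comment> \<open>A common right factor of \<open>U\<close> and \<open>W\<close> does not change
    the fraction, so the weight at the base corner can be normalized to 1.\<close>
  define w where "w n = cW n * inverse (cW 0)" for n
  define z where "z = (\<lambda>n. (p n * w n, w n))"
  have w0: "w 0 = 1" and w: "w n \<noteq> 0" if "n \<le> 7" for n using corner that corner[of 0] by (simp_all add: w_def)
  define g where "g = cW 0"
  have g: "g \<noteq> 0" using corner[of 0] by (simp add: g_def)
  have cz: "cU n = fst (z n) * g" "cW n = snd (z n) * g" if "n \<le> 7" for n
    using corner[of 0] corner[OF that] by (simp_all add: z_def w_def g_def mult.assoc)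
  have "U s t u = fst (trilin z s t u) * g" "W s t u = snd (trilin z s t u) * g" for s t u
    by (simp_all add: c trilin_lerp lerp_def fst_lerp snd_lerp cz distrib_right)
  then have Gz: "G s t u = hproj (trilin z s t u)" if "s \<in> {0..1}" "t \<in> {0..1}" "u \<in> {0..1}" for s t u
    using GUW[OF that] hproj_scale[of 1 g "trilin z s t u"] g
    by (simp add: hproj_def)
  then have ag: "agrees G z" by (simp add: agrees_def)
  have iso: "isotropic_cube z"
    unfolding isotropic_cube_def hproj_in_hatR3_iff[symmetric]
    using G(1) Gz unfolding dc_cube_def by simp
  have orth: "orthogonal (hS z t u) (hS (cyc z) u s) \<and> orthogonal (hS z t u) (hS (cyc (cyc z)) s t)
      \<and> orthogonal (hS (cyc z) u s) (hS (cyc (cyc z)) s t)"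
    if stu: "s \<in> {0..1}" "t \<in> {0..1}" "u \<in> {0..1}" and W: "snd (trilin z s t u) \<noteq> 0" for s t u
  proof -
    have "G s t u \<noteq> Infty" using W Gz[OF stu] by (simp add: hproj_eq_Infty_iff)
    then have "orthogonal (pd_s G s t u) (pd_t G s t u) \<and>
        orthogonal (pd_s G s t u) (pd_u G s t u) \<and> orthogonal (pd_t G s t u) (pd_u G s t u)"
      using G(1) stu unfolding dc_cube_def by blast
    then show ?thesis
      unfolding pd_s_eq[OF iso ag stu refl W] pd_t_eq[OF iso ag stu refl W] pd_u_eq[OF iso ag stu refl W]
      using W by (simp add: orthogonal_mult_mult)
  qed
  have "orth_cube z" using orth by (simp add: orth_cube_def)
  moreover have "orth_cube (cyc z)"
    using orth unfolding orth_cube_def trilin_cyc[of z] by blast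
  moreover have "orth_cube (cyc (cyc z))"
    using orth unfolding orth_cube_def trilin_cyc[of z] trilin_cyc[of "cyc z"] hS_cyc_cyc_cyc
    by (metis orthogonal_commute)
  ultimately show ?thesis using that[of w] w0 w ag iso unfolding z_def by blast
qed

text \<open>This turns positive factors in the weights into changes of parameter: the factor in
  front disappears under \<open>hproj\<close>.\<close>

lemma lerp_moebius01:
  assumes "a > 0" "x \<in> {0..1}"
  shows "lerp x y (a *\<^sub>R y') = ((1 - x) + a * x) *\<^sub>R lerp (moebius01 a x) y y'" "(1 - x) + a * x > 0"
proof -
  show pos: "(1 - x) + a * x > 0"
    using assms by (cases "x = 1") (auto intro: add_pos_nonneg)
  then have "((1 - x) + a * x) * moebius01 a x = a * x" "((1 - x) + a * x) * (1 - moebius01 a x) = 1 - x"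
    by (simp_all add: moebius01_def field_simps)
  then show "lerp x y (a *\<^sub>R y') = ((1 - x) + a * x) *\<^sub>R lerp (moebius01 a x) y y'"
    by (simp add: lerp_def scaleR_add_right mult.commute)
qed

lemma lerp_scaleR: "lerp x (r *\<^sub>R a) (r *\<^sub>R b) = r *\<^sub>R lerp x a b"
  by (simp add: lerp_def scaleR_add_right mult.commute)

lemma trilin_moebius01:
  assumes abc: "a > 0" "b > 0" "c > 0" and stu: "s \<in> {0..1}" "t \<in> {0..1}" "u \<in> {0..1}"
    and z: "z' 0 = z 0" "z' 1 = a *\<^sub>R z 1" "z' 2 = b *\<^sub>R z 2" "z' 3 = (a * b) *\<^sub>R z 3"
      "z' 4 = c *\<^sub>R z 4" "z' 5 = (c * a) *\<^sub>R z 5" "z' 6 = (b * c) *\<^sub>R z 6" "z' 7 = (a * b * c) *\<^sub>R z 7"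
  obtains r where "r > 0" "trilin z' s t u = r *\<^sub>R trilin z (moebius01 a s) (moebius01 b t) (moebius01 c u)"
proof -
  have 3: "z' 3 = a *\<^sub>R b *\<^sub>R z 3" and 5: "z' 5 = a *\<^sub>R c *\<^sub>R z 5" and 6: "z' 6 = b *\<^sub>R c *\<^sub>R z 6"
    and 7: "z' 7 = a *\<^sub>R b *\<^sub>R c *\<^sub>R z 7" using z by (simp_all add: mult_ac)
  note m = lerp_moebius01
  have "trilin z' s t u = ((1 - s + a * s) * ((1 - t + b * t) * (1 - u + c * u))) *\<^sub>R
      trilin z (moebius01 a s) (moebius01 b t) (moebius01 c u)"
    unfolding trilin_lerp z(1,2,3,5) 3 5 6 7 lerp_scaleR m(1)[OF abc(1) stu(1)] m(1)[OF abc(2) stu(2)] m(1)[OF abc(3) stu(3)]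
    by simp
  moreover have "(1 - s + a * s) * ((1 - t + b * t) * (1 - u + c * u)) > 0"
    using m(2)[OF abc(1) stu(1)] m(2)[OF abc(2) stu(2)] m(2)[OF abc(3) stu(3)] by simp
  ultimately show ?thesis using that by blast
qed

theorem theorem4p3:
  fixes p q w :: "nat \<Rightarrow> quat" and v1 v2 v3 :: quat
    and F :: "real \<Rightarrow> real \<Rightarrow> real \<Rightarrow> hquat"
  assumes finite_points: "\<forall>i\<in>{0..7}. p i \<in> ImH"
    and q_exist: "\<forall>i\<in>{1..7}. p i \<noteq> p 0"
    and circles_exist:
      "distinct [p 0, p 1, p 2]" "distinct [p 0, p 1, p 4]" "distinct [p 0, p 2, p 4]"
      "distinct [p 1, p 3, p 5]" "distinct [p 2, p 3, p 6]" "distinct [p 4, p 5, p 6]"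
    and p3: "Fin (p 3) \<in> circle_through (p 0) (p 1) (p 2)"
    and p5: "Fin (p 5) \<in> circle_through (p 0) (p 1) (p 4)"
    and p6: "Fin (p 6) \<in> circle_through (p 0) (p 2) (p 4)"
    and p7: "miquel_point p (p 7)"
    and frame_im: "v1 \<in> ImH" "v2 \<in> ImH" "v3 \<in> ImH"
    and frame_unit: "norm v1 = 1" "norm v2 = 1" "norm v3 = 1"
    and frame_orth: "orthogonal v1 v2" "orthogonal v1 v3" "orthogonal v2 v3"
    and frame_prod: "v3 = v1 * v2"
    and q: "\<forall>i\<in>{1..7}. q i = inverse (p i - p 0)"
    and w0: "w 0 = 1"
    and w1: "w 1 = q 1 * v1"
    and w2: "w 2 = q 2 * v2"
    and w4: "w 4 = q 4 * v3"
    and w3: "w 3 = q 3 * (q 1 - q 2) * v3"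
    and w5: "w 5 = q 5 * (q 4 - q 1) * v2"
    and w6: "w 6 = q 6 * (q 2 - q 4) * v1"
    and w7: "w 7 = - q 7 * inverse (q 7 - q 1) * (q 4 - q 1) * (q 3 - q 5) * (q 1 - q 2)"
    and F: "\<And>s t u. F s t u = qfrac
      (\<Sum>i\<le>1. \<Sum>j\<le>1. \<Sum>k\<le>1. (Bernstein 1 i s * Bernstein 1 j t * Bernstein 1 k u) *\<^sub>R
         (p (i + 2 * j + 4 * k) * w (i + 2 * j + 4 * k)))
      (\<Sum>i\<le>1. \<Sum>j\<le>1. \<Sum>k\<le>1. (Bernstein 1 i s * Bernstein 1 j t * Bernstein 1 k u) *\<^sub>R
         w (i + 2 * j + 4 * k))"
  shows "w 7 = - q 7 * inverse (q 7 - q 2) * (q 1 - q 2) * (q 6 - q 3) * (q 2 - q 4)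
       \<and> w 7 = - q 7 * inverse (q 7 - q 4) * (q 2 - q 4) * (q 5 - q 6) * (q 4 - q 1)
       \<and> q 7 \<noteq> q 1 \<and> q 7 \<noteq> q 2 \<and> q 7 \<noteq> q 4
       \<and> dc_cube F \<and> has_corners F p \<and> has_frame F v1 v2 v3
       \<and> (\<forall>G. dc_cube G \<and> has_corners G p \<and> has_frame G v1 v2 v3 \<longrightarrow> reparametrization G F)"
proof -
  have pI: "p n \<in> ImH" if "n \<le> 7" for n using finite_points that by simp
  have pne: "p n \<noteq> p 0" if "n \<in> {1..7}" for n using q_exist that by blast
  have qn: "q n = inverse (p n - p 0)" if "n \<in> {1..7}" for n using q that by blast
  have q_ImH: "q n \<in> ImH" and q_nz: "q n \<noteq> 0" if "n \<in> {1..7}" for n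
    using qn[OF that] pI[of n] pI[of 0] pne[OF that] that by simp_all
  have q_inj: "q i = q j \<longleftrightarrow> p i = p j" if "i \<in> {1..7}" "j \<in> {1..7}" for i j
    using qn that by simp
  define M N L where "M = q 1 - q 2" "N = q 2 - q 4" "L = q 4 - q 1"
  have sum: "M + N + L = 0" by (simp add: M_N_L_def)
  have MNL_ImH: "M \<in> ImH" "N \<in> ImH" "L \<in> ImH" unfolding M_N_L_def using q_ImH by simp_all
  have MNL_nz: "M \<noteq> 0" "N \<noteq> 0" "L \<noteq> 0"
    using circles_exist q_inj[of 1 2] q_inj[of 2 4] q_inj[of 4 1] by (auto simp: M_N_L_def)
  obtain C where C: "gen_circle C" "Fin (p 0) \<in> C" "Fin (p 1) \<in> C" "Fin (p 2) \<in> C" "Fin (p 3) \<in> C"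
    using p3 by (rule circle_throughD)
  \<comment> \<open>The circle passes through \<open>p 0\<close>, so its image is the line through
    \<open>q 1\<close> and \<open>q 2\<close>; \<open>\<alpha>\<close> is the affine coordinate of
    \<open>q 3\<close> on it. \<open>\<beta>\<close> and \<open>\<gamma>\<close> arise in the same
    way.\<close>
  obtain \<alpha> where \<alpha>: "\<alpha> \<noteq> 0" "\<alpha> \<noteq> 1" "q 3 = q 2 + \<alpha> *\<^sub>R M"
  proof (rule gen_circle_line_param[OF C(1-5)])
    fix k assume "k \<noteq> 0" "k \<noteq> 1"
      "inverse (p 3 - p 0) = inverse (p 2 - p 0) + k *\<^sub>R (inverse (p 1 - p 0) - inverse (p 2 - p 0))"
    then show ?thesis using that[of k] by (simp add: M_N_L_def qn)
  qed (use pI pne circles_exist in auto)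
  obtain C6 where C6: "gen_circle C6" "Fin (p 0) \<in> C6" "Fin (p 2) \<in> C6" "Fin (p 4) \<in> C6" "Fin (p 6) \<in> C6"
    using p6 by (rule circle_throughD)
  obtain \<beta> where \<beta>: "\<beta> \<noteq> 0" "\<beta> \<noteq> 1" "q 6 = q 4 + \<beta> *\<^sub>R N"
  proof (rule gen_circle_line_param[OF C6(1-5)])
    fix k assume "k \<noteq> 0" "k \<noteq> 1"
      "inverse (p 6 - p 0) = inverse (p 4 - p 0) + k *\<^sub>R (inverse (p 2 - p 0) - inverse (p 4 - p 0))"
    then show ?thesis using that[of k] by (simp add: M_N_L_def qn)
  qed (use pI pne circles_exist in auto)
  obtain C5 where C5: "gen_circle C5" "Fin (p 0) \<in> C5" "Fin (p 1) \<in> C5" "Fin (p 4) \<in> C5" "Fin (p 5) \<in> C5"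
    using p5 by (rule circle_throughD)
  obtain \<gamma> where \<gamma>: "\<gamma> \<noteq> 0" "\<gamma> \<noteq> 1" "q 5 = q 1 + \<gamma> *\<^sub>R L"
  proof (rule gen_circle_line_param[OF C5(1,2,4,3,5)])
    fix k assume "k \<noteq> 0" "k \<noteq> 1"
      "inverse (p 5 - p 0) = inverse (p 1 - p 0) + k *\<^sub>R (inverse (p 4 - p 0) - inverse (p 1 - p 0))"
    then show ?thesis using that[of k] by (simp add: M_N_L_def qn)
  qed (use pI pne circles_exist in auto)

  have m7: "Fin (p 7) \<in> circle_through (p 1) (p 3) (p 5)" "Fin (p 7) \<in> circle_through (p 2) (p 3) (p 6)"
      "Fin (p 7) \<in> circle_through (p 4) (p 5) (p 6)"
    using p7 unfolding miquel_point_def by auto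
  \<comment> \<open>If the triangle degenerates, the points \<open>q 4\<close>, \<open>q 5\<close>,
    \<open>q 6\<close> lie on the line through \<open>q 1\<close> and \<open>q 2\<close>. Then
    \<open>C\<close> lies in all three Miquel circles, which contradicts their having a single
    common point.\<close>
  have indep: "a = 0 \<and> b = 0" if ab: "a *\<^sub>R M + b *\<^sub>R N = 0" for a b
  proof (rule ccontr)
    assume "\<not> (a = 0 \<and> b = 0)"
    then have "b \<noteq> 0" using ab MNL_nz by auto
    then have "N = (- a / b) *\<^sub>R M"
    proof -
      have "b *\<^sub>R N = - (a *\<^sub>R M)" using ab by (simp add: add_eq_0_iff)
      then have "(1 / b) *\<^sub>R b *\<^sub>R N = (1 / b) *\<^sub>R - (a *\<^sub>R M)" by simp
      then show ?thesis using \<open>b \<noteq> 0\<close> by simp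
    qed
    then obtain k where k: "N = k *\<^sub>R M" by blast
    have mem: "Fin (p n) \<in> C" if "n \<in> {1..7}" "q n = q 1 + t *\<^sub>R (q 2 - q 1)" for n t
      by (rule gen_circle_contains_inverse_line[OF C(1-4)]) (use that pI pne qn in auto)
    have "q 4 = q 1 + (1 + k) *\<^sub>R (q 2 - q 1)"
      using k by (simp add: M_N_L_def algebra_simps)
    then have "Fin (p 4) \<in> C" by (intro mem) simp
    have "q 5 = q 1 + (\<gamma> * (1 + k)) *\<^sub>R (q 2 - q 1)"
      using \<gamma>(3) by (simp add: M_N_L_def \<open>q 4 = _\<close>)
    then have "Fin (p 5) \<in> C" by (intro mem) simp
    have "q 6 = q 1 + (1 + k - \<beta> * k) *\<^sub>R (q 2 - q 1)"
      using \<beta>(3) \<open>q 4 = _\<close> k by (simp add: M_N_L_def algebra_simps)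
    then have "Fin (p 6) \<in> C" by (intro mem) simp
    have "C \<subseteq> circle_through (p 1) (p 3) (p 5) \<inter> circle_through (p 2) (p 3) (p 6)
       \<inter> circle_through (p 4) (p 5) (p 6)"
      using C \<open>Fin (p 4) \<in> C\<close> \<open>Fin (p 5) \<in> C\<close> \<open>Fin (p 6) \<in> C\<close> by (auto intro: circle_throughI)
    then have "C \<subseteq> {Fin (p 7)}" by (simp only: p7[unfolded miquel_point_def])
    then have "p 1 = p 7" "p 3 = p 7" using C by auto
    then show False using circles_exist by simp
  qed
  define m where "m = apex M N L \<alpha> \<beta> \<gamma>"
  have cross: "q 3 - q 1 = (\<alpha> - 1) *\<^sub>R M" "q 5 - q 1 = \<gamma> *\<^sub>R L" "q 6 - q 2 = (\<beta> - 1) *\<^sub>R N"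
    "q 3 - q 2 = \<alpha> *\<^sub>R M" "q 5 - q 4 = (\<gamma> - 1) *\<^sub>R L" "q 6 - q 4 = \<beta> *\<^sub>R N"
    using \<alpha>(3) \<beta>(3) \<gamma>(3) by (simp_all add: M_N_L_def algebra_simps)
  \<comment> \<open>Inversion at \<open>p 0\<close> keeps the points concyclic, and subtracting
    \<open>q a\<close> brings one of them to the origin as \<open>miquel_apex\<close>
    requires.\<close>
  have on_circle: "(0 - (q b - q a)) * ((q b - q a) - (q d - q a)) * ((q d - q a) - (q 7 - q a)) * ((q 7 - q a) - 0) \<in> \<real>"
    if "gen_circle C'" "Fin (p a) \<in> C'" "Fin (p b) \<in> C'" "Fin (p d) \<in> C'" "Fin (p 7) \<in> C'"
      "a \<in> {1..7}" "b \<in> {1..7}" "d \<in> {1..7}" for C' a b d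
  proof -
    have "(q a - q b) * (q b - q d) * (q d - q 7) * (q 7 - q a) \<in> \<real>"
      using gen_circle_product_real_inverse[OF that(1-5), of "p 0"] that(6-8) pI pne by (simp add: qn)
    then show ?thesis by simp
  qed
  obtain D1 where D1: "gen_circle D1" "Fin (p 1) \<in> D1" "Fin (p 3) \<in> D1" "Fin (p 5) \<in> D1" "Fin (p 7) \<in> D1"
    using m7(1) by (rule circle_throughD)
  obtain D2 where D2: "gen_circle D2" "Fin (p 2) \<in> D2" "Fin (p 3) \<in> D2" "Fin (p 6) \<in> D2" "Fin (p 7) \<in> D2"
    using m7(2) by (rule circle_throughD)
  obtain D4 where D4: "gen_circle D4" "Fin (p 4) \<in> D4" "Fin (p 5) \<in> D4" "Fin (p 6) \<in> D4" "Fin (p 7) \<in> D4"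
    using m7(3) by (rule circle_throughD)
  have idx: "(1 :: nat) \<in> {1..7}" "(2 :: nat) \<in> {1..7}" "(3 :: nat) \<in> {1..7}"
    "(4 :: nat) \<in> {1..7}" "(5 :: nat) \<in> {1..7}" "(6 :: nat) \<in> {1..7}"
    by simp_all
  have y: "q 7 - q 1 + M = q 7 - q 2" "q 7 - q 1 - L = q 7 - q 4" by (simp_all add: M_N_L_def)
  have q7m: "(q 7 - q 1) * m = - (L * (q 3 - q 5) * M)"
  proof -
    have "(q 7 - q 1) * m = - (L * ((\<alpha> - 1) *\<^sub>R M - \<gamma> *\<^sub>R L) * M)"
      unfolding m_def
      by (rule miquel_apex[OF MNL_ImH(1,2) _ sum indep \<alpha>(1,2) \<beta>(1,2) \<gamma>(1,2)
            on_circle[OF D1 idx(1,3,5), unfolded cross]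
            on_circle[OF D2(1,2,4,3,5) idx(2,6,3), unfolded cross y[symmetric]]
            on_circle[OF D4 idx(4,5,6), unfolded cross y[symmetric]]])
        (use q_ImH in simp_all)
    then show ?thesis by (simp add: cross[symmetric])
  qed
  note v_mult = quaternion_frame[OF frame_im(1,2) frame_unit(1,2) frame_orth(1) frame_prod]
  interpret f1: miquel_frame v1 v2 v3 "q 1" "q 2" "q 4" "q 3" "q 6" "q 5" "q 7" M N L m \<alpha> \<beta> \<gamma>
    by unfold_locales (use frame_im v_mult MNL_ImH \<alpha> \<beta> \<gamma> q7m in \<open>simp_all add: M_N_L_def m_def\<close>)
  interpret f2: miquel_frame v2 v3 v1 "q 2" "q 4" "q 1" "q 6" "q 5" "q 3" "q 7" N L M m \<beta> \<gamma> \<alpha>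
    by (rule f1.rotate)
  interpret f3: miquel_frame v3 v1 v2 "q 4" "q 1" "q 2" "q 5" "q 3" "q 6" "q 7" L M N m \<gamma> \<alpha> \<beta>
    by (rule f2.rotate)
  have d35: "q 3 \<noteq> q 5" and d63: "q 6 \<noteq> q 3" and d56: "q 5 \<noteq> q 6"
    using circles_exist q_inj[of 3 5] q_inj[of 6 3] q_inj[of 5 6] by auto
  \<comment> \<open>The three products equal nonzero quaternions, so neither of their factors can
    vanish.\<close>
  have q7_ne: "q 7 \<noteq> q 1" "q 7 \<noteq> q 2" "q 7 \<noteq> q 4" and m_nz: "m \<noteq> 0"
    using f1.q7 f1.q7_q2 f1.q7_q4 MNL_nz d35 d63 d56 by auto
  have m_eq: "m = - (inverse Y * X)" if "Y * m = - X" "Y \<noteq> 0" for X Y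
  proof -
    have "inverse Y * (Y * m) = - (inverse Y * X)" by (simp add: that(1))
    then show ?thesis using that(2) by (simp add: mult.assoc[symmetric])
  qed
  have w7m: "w 7 = q 7 * m"
    unfolding w7 M_N_L_def[symmetric] using m_eq[OF f1.q7] q7_ne by (simp add: mult.assoc)
  have w7_2: "w 7 = - q 7 * inverse (q 7 - q 2) * (q 1 - q 2) * (q 6 - q 3) * (q 2 - q 4)"
    unfolding w7m M_N_L_def[symmetric] using m_eq[OF f1.q7_q2] q7_ne by (simp add: mult.assoc)
  have w7_4: "w 7 = - q 7 * inverse (q 7 - q 4) * (q 2 - q 4) * (q 5 - q 6) * (q 4 - q 1)"
    unfolding w7m M_N_L_def[symmetric] using m_eq[OF f1.q7_q4] q7_ne by (simp add: mult.assoc)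

  define c where "c n = inverse (q n) * w n" for n
  have wc: "w n = q n * c n" if "n \<in> {1..7}" for n
    using q_nz[OF that] by (simp add: c_def mult.assoc[symmetric])
  have c: "c 1 = v1" "c 2 = v2" "c 4 = v3" "c 3 = M * v3" "c 5 = L * v2" "c 6 = N * v1" "c 7 = m"
    using q_nz by (simp_all add: c_def w1 w2 w3 w4 w5 w6 w7m M_N_L_def mult.assoc[symmetric] del: One_nat_def)
  define z where "z = (\<lambda>n. (p n * w n, w n))"
  have fc: "frame_cube z c q"
    unfolding z_def by (rule frame_cube_corners) (use pI pne qn w0 wc in auto)
  have fc2: "frame_cube (cyc z) (cyc c) (cyc q)" by (rule frame_cube_cyc[OF fc])
  have fc3: "frame_cube (cyc (cyc z)) (cyc (cyc c)) (cyc (cyc q))" by (rule frame_cube_cyc[OF fc2])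
  \<comment> \<open>Shifting the corner indices by \<open>cyc\<close> matches the rotated
    interpretations \<open>f2\<close> and \<open>f3\<close>.\<close>
  have span: "hS z t u \<in> span {v1}" "hS (cyc z) t u \<in> span {v2}" "hS (cyc (cyc z)) t u \<in> span {v3}" for t u
    using f1.hS_in_span[OF fc] f2.hS_in_span[OF fc2] f3.hS_in_span[OF fc3] c c(1)[unfolded One_nat_def]
    by (simp_all del: One_nat_def)
  have w_nz: "w n \<noteq> 0" if "n \<le> 7" for n
  proof (cases "n = 0")
    case False
    then have n: "n \<in> {1, 2, 3, 4, 5, 6, 7}" using that by auto
    moreover have "c n \<noteq> 0" using n c MNL_nz m_nz f1.v_nonzero by auto
    ultimately show ?thesis using wc[of n] q_nz[of n] by auto
  qed (simp add: w0)
  have iso: "isotropic_cube z"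
  proof (rule isotropic_cubeI)
    show "hform (z n) (z n) = 0" if "n \<le> 7" for n
      using pI[OF that] by (simp add: z_def hform_def qcnj_ImH mult.assoc)
  qed (use span span_ImH frame_im in blast)+
  have F_eq: "F s t u = hproj (trilin z s t u)" for s t u
    by (simp add: F hproj_def fst_trilin snd_trilin z_def trilin_def)
  then have ag: "agrees F z" by (simp add: agrees_def)
  have base: "snd (z 0) = 1" "hform (z 0) (z 1) = v1" "hform (z 0) (z 2) = v2" "hform (z 0) (z 4) = v3"
    using fc c by (simp_all add: frame_cube_def z_def w0)
  note dc = dc_cubeI[OF iso ag span base frame_im frame_unit frame_orth frame_prod]
  have corners: "has_corners F p"
    unfolding has_corners_def F_eq
  proof (intro ballI)
    fix i j k :: nat assume ijk: "i \<in> {0,1}" "j \<in> {0,1}" "k \<in> {0,1}"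
    then have "i + 2 * j + 4 * k \<le> 7" by auto
    then show "hproj (trilin z (real i) (real j) (real k)) = Fin (p (i + 2 * j + 4 * k))"
      using w_nz by (simp add: trilin_corner[OF ijk] hproj_def qfrac_def z_def mult.assoc)
  qed

  have unique: "reparametrization G F" if G: "dc_cube G" "has_corners G p" "has_frame G v1 v2 v3" for G
  proof -
    obtain w' where w': "w' 0 = 1" "\<And>n. n \<le> 7 \<Longrightarrow> w' n \<noteq> 0" and ag': "agrees G (\<lambda>n. (p n * w' n, w' n))"
      and cube': "isotropic_cube (\<lambda>n. (p n * w' n, w' n))" "orth_cube (\<lambda>n. (p n * w' n, w' n))"
      "orth_cube (cyc (\<lambda>n. (p n * w' n, w' n)))" "orth_cube (cyc (cyc (\<lambda>n. (p n * w' n, w' n))))"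
      using dc_cube_coordinates[OF G(1,2)] by blast
    define z' where "z' = (\<lambda>n. (p n * w' n, w' n))"
    note ag' = ag'[folded z'_def] and cube' = cube'[folded z'_def]
    define c' where "c' n = inverse (q n) * w' n" for n
    have wc': "w' n = q n * c' n" if "n \<in> {1..7}" for n
      using q_nz[OF that] by (simp add: c'_def mult.assoc[symmetric])
    have fc': "frame_cube z' c' q"
      unfolding z'_def by (rule frame_cube_corners) (use pI pne qn w' wc' in auto)
    have h0: "hform (z' 0) (z' n) = c' n" if "n \<in> {1..7}" for n
      using fc' that unfolding frame_cube_def by blast
    have h: "hform (z' n) (z' k) = qcnj (c' n) * (q k - q n) * c' k" if "n \<in> {1..7}" "k \<in> {1..7}" for n k
      using fc' that unfolding frame_cube_def by blast
    have z'0: "trilin z' 0 0 0 = z' 0" "snd (z' 0) = 1" by (simp_all add: trilin_lerp z'_def w')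
    have "pd_s G 0 0 0 = c' 1" "pd_t G 0 0 0 = c' 2" "pd_u G 0 0 0 = c' 4"
      using pd_s_eq[OF cube'(1) ag', of 0 0 0 1] pd_t_eq[OF cube'(1) ag', of 0 0 0 1]
        pd_u_eq[OF cube'(1) ag', of 0 0 0 1] h0[of 1] h0[of 2] h0[of 4]
      by (simp_all add: z'0 hS_def trilin_lerp)
    then have sgn: "sgn (c' 1) = v1" "sgn (c' 2) = v2" "sgn (c' 4) = v3"
      using G(3) by (simp_all add: has_frame_def)
    have scaled: "x = norm x *\<^sub>R v \<and> norm x > 0" if "sgn x = v" "v \<noteq> 0" for x v :: quat
      using that by (auto simp: sgn_div_norm)
    \<comment> \<open>The frame prescribes only the directions of the derivatives at
      \<open>p 0\<close>; their lengths \<open>a\<close>, \<open>b\<close>, \<open>d\<close> are the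
      remaining freedom.\<close>
    obtain a b d where abd: "a > 0" "b > 0" "d > 0" and c'124: "c' 1 = a *\<^sub>R v1" "c' 2 = b *\<^sub>R v2" "c' 4 = d *\<^sub>R v3"
      using scaled[OF sgn(1)] scaled[OF sgn(2)] scaled[OF sgn(3)] f1.v_nonzero by blast
    have nz': "snd (z' n) \<noteq> 0" if "n \<le> 7" for n using w'(2)[OF that] by (simp add: z'_def)
    have nz2: "snd (cyc z' n) \<noteq> 0" and nz3: "snd (cyc (cyc z') n) \<noteq> 0" if "n \<le> 7" for n
      using that nz' by (auto simp: cyc_def)
    have iso2: "isotropic_cube (cyc z')" and iso3: "isotropic_cube (cyc (cyc z'))"
      using cube'(1) by (simp_all add: isotropic_cube_cyc)
    have face3: "orth_face (z' 0) (z' 1) (z' 2) (z' 3)" and face456: "orth_face (z' 4) (z' 5) (z' 6) (z' 7)"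
      using orth_face_0123[OF cube'(1,2) nz'] orth_face_4567[OF cube'(1,2) nz'] by blast+
    have face6: "orth_face (z' 0) (z' 2) (z' 4) (z' 6)" and face135: "orth_face (z' 1) (z' 3) (z' 5) (z' 7)"
      using orth_face_0123[OF iso2 cube'(3) nz2] orth_face_4567[OF iso2 cube'(3) nz2] by simp_all
    have face5: "orth_face (z' 0) (z' 4) (z' 1) (z' 5)" and face263: "orth_face (z' 2) (z' 6) (z' 3) (z' 7)"
      using orth_face_0123[OF iso3 cube'(4) nz3] orth_face_4567[OF iso3 cube'(4) nz3] by simp_all
    have c'3: "c' 3 = (a * b) *\<^sub>R (M * v3)"
      by (rule f1.face_weight[OF face3]) (use h0 h c'124 abd \<alpha> MNL_nz in auto)
    have c'6: "c' 6 = (b * d) *\<^sub>R (N * v1)"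
      by (rule f2.face_weight[OF face6]) (use h0 h c'124 abd \<beta> MNL_nz in auto)
    have c'5: "c' 5 = (d * a) *\<^sub>R (L * v2)"
      by (rule f3.face_weight[OF face5]) (use h0 h c'124 abd \<gamma> MNL_nz in auto)
    have c'7: "c' 7 = (a * b * d) *\<^sub>R m"
      by (rule f1.apex_weight[OF face135 face263 face456])
        (use h c'124 c'3 c'5 abd \<alpha> \<gamma> MNL_nz d35 in \<open>auto simp del: qcnj_simps\<close>)
    have zz: "z' n = r *\<^sub>R z n" if "n \<in> {1..7}" "c' n = r *\<^sub>R c n" for n r
      using wc[OF that(1)] wc'[OF that(1)] that(2) by (simp add: z_def z'_def)
    \<comment> \<open>Each corner is scaled by the product of the factors belonging to its nonzero
      binary digits, the pattern produced by \<open>moebius01\<close> in each variable.\<close>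
    have z's: "z' 0 = z 0" "z' 1 = a *\<^sub>R z 1" "z' 2 = b *\<^sub>R z 2" "z' 3 = (a * b) *\<^sub>R z 3"
      "z' 4 = d *\<^sub>R z 4" "z' 5 = (d * a) *\<^sub>R z 5" "z' 6 = (b * d) *\<^sub>R z 6" "z' 7 = (a * b * d) *\<^sub>R z 7"
      by (simp add: z_def z'_def w0 w') (rule zz; simp add: c c'124 c'3 c'5 c'6 c'7 del: One_nat_def)+
    have "G s t u = F (moebius01 a s) (moebius01 b t) (moebius01 d u)"
      if stu: "s \<in> {0..1}" "t \<in> {0..1}" "u \<in> {0..1}" for s t u
    proof -
      obtain r where "r > 0" "trilin z' s t u = r *\<^sub>R trilin z (moebius01 a s) (moebius01 b t) (moebius01 d u)"
        by (rule trilin_moebius01[OF abd stu z's])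
      then show ?thesis
        using ag' stu hproj_scale[of r 1 "trilin z (moebius01 a s) (moebius01 b t) (moebius01 d u)"]
        by (simp add: agrees_def F_eq scaleR_prod_def)
    qed
    then show ?thesis unfolding reparametrization_def using abd by blast
  qed
  show ?thesis using w7_2 w7_4 q7_ne dc corners unique by blast
qed

end
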